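(* Let $M=(M,d,E)$ be a model of $\mathsf{MSE}$ and let $a\in M$ be a uniformly discrete set such that $M\models\mathsf{Inf}(a)$. Then $(\mathbb N_a,\mathcal P(\mathbb N_a),\mathcal P^2(\mathbb N_a),\dots)$, with membership $E$ between consecutive sorts, zero element $0=\{\varnothing\}$ and successor function $\mathrm{succ}_a$ on $\mathbb N_a$, is a model of full $\omega$th-order arithmetic.
   Context: Metric set structures. For a metric space $(M,d)$ with $[0,1]$-valued metric and $A,B\subseteq M$, $d_{\mathrm H}(A,B)$ is the $[0,1]$-valued Hausdorff distance: the least $t\in[0,1]$ such that for every $r>t$ each point of $A$ is at distance $<r$ from some point of $B$ and vice versa; by convention $d_{\mathrm H}(\varnothing,\varnothing)=0$ and $d_{\mathrm H}(\varnothing,A)=1$ for $A\neq\varnothing$. A metric set structure is a triple $(M,d,E)$ with $(M,d)$ a (nonempty) complete metric space, $d$ $[0,1]$-valued, and $E\subseteq M^2$ a closed binary relation with $d(a,b)=d_{\mathrm H}(\{x:x\,E\,a\},\{x:x\,E\,b\})$ for all $a,b\in M$. Elements of $M$ are called sets, and $x\,E\,y$ is read "$x$ is an element of $y$". Formulas are the smallest collection of expressions containing $1$ and $d(x,y)$ ($x,y$ variables) and closed under $\varphi+\psi$, $\max(\varphi,\psi)$, $\min(\varphi,\psi)$, $r\cdot\varphi$ ($r\in\mathbb R$), $\sup_x\varphi$, $\inf_x\varphi$, $\sup_{x E y}\varphi$, $\inf_{x E y}\varphi$. Put $v(1)=v(d(x,y))=1$, $v(\varphi+\psi)=v(\varphi)+v(\psi)$,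 $v(\max(\varphi,\psi))=v(\min(\varphi,\psi))=\max(v(\varphi),v(\psi))$, $v(r\varphi)=|r|v(\varphi)$, and quantifiers do not change $v$. The real value $\varphi^M(\bar a)$ is defined in the obvious way (bounded quantifiers range over $\{x: x\,E\,a\}$), except that if $a$ has no elements then $\sup_{xEa}\varphi$ has value $-v(\varphi)$ and $\inf_{xEa}\varphi$ has value $v(\varphi)$. $(M,d,E)$ is a model of $\mathsf{MSE}$ if it is a metric set structure satisfying excision: for every formula $\varphi(x,\bar y)$, reals $r<s$ and $\bar a\in M$ there is $b\in M$ such that for all $c\in M$: $\varphi^M(c,\bar a)\le r$ implies $c\,E\,b$, and $c\,E\,b$ implies $\varphi^M(c,\bar a)<s$. $a\sqsubseteq b$ means every element of $a$ is an element of $b$. A set $a$ is uniformly discrete if for some $\varepsilon>0$ any two distinct elements of $a$ are at distance $\ge\varepsilon$. In a model of $\mathsf{MSE}$ the empty set $\varnothing$, finite sets, ordered pairs $\langle a,b\rangle=\{\{\{a\},\varnothing\},\{\{b\}\}\}$, products $a\times b$ (set of pairs $\langle x,y\rangle$ with $x\,E\,a$, $y\,E\,b$) and power sets $\mathcal P(a)$ (set of all $c\sqsubseteq a$) exist as unique elements of the model. For $a$ uniformly discrete and $c,f\sqsubseteq a$, $c\approx_a f$ means that some set $g\sqsubseteq a\times a$ is the graph of a bijection from the elements of $c$ to those of $f$. $|c|_a$ is the set whose elements are the $f\sqsubseteq a$ with $c\approx_a f$. For $b\sqsubseteq\mathcal P(a)$, $\mathrm{succ}_a(b)$ is the set of those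 $c\sqsubseteq a$ for which there is $f\,E\,b$ with $f\sqsubseteq c$ such that exactly one $g$ satisfies $g\,E\,c$ and not $g\,E\,f$. Let $0=\{\varnothing\}$. A set $y\sqsubseteq\mathcal P^2(a)$ is inductive if $0\,E\,y$ and for every $x\,E\,y$ either $\mathrm{succ}_a(x)\,E\,y$ or $\mathrm{succ}_a(x)=\varnothing$. $\mathbb N_a$ is the set of all $x\,E\,\mathcal P^2(a)$ that are elements of every inductive $y\sqsubseteq\mathcal P^2(a)$. $\mathsf{Inf}(a)$ says that $|a|_a$ is not an element of $\mathbb N_a$. A model of full $\omega$th-order arithmetic is a many-sorted structure with sorts $T_0,T_1,T_2,\dots$, membership relations between $T_n$ and $T_{n+1}$, and $0\in T_0$, $S:T_0\to T_0$ satisfying: $S$ is injective and $0$ is not in its range; induction (every $X\in T_1$ containing $0$ and closed under $S$ contains all of $T_0$); extensionality for each $T_{n+1}$; and full comprehension: for every $n$ and every formula $\Phi(x,\bar p)$ of the many-sorted language with $x$ of sort $T_n$ and parameters $\bar p$ of any sorts, there is $X\in T_{n+1}$ whose members are exactly the $x\in T_n$ satisfying $\Phi(x,\bar p)$. Here $T_n$ is interpreted as the collection of elements of $\mathcal P^n(\mathbb N_a)$. *)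

theory Defs
  imports "HOL-Analysis.Analysis"
begin

section \<open>Metric set structures\<close>

(* The cases with an empty argument are conventions; for nonempty A and B the set of admissible t
   contains 1 and is closed from below, so the least element exists. *)
definition hausdorff01 :: "('a \<Rightarrow> 'a \<Rightarrow> real) \<Rightarrow> 'a set \<Rightarrow> 'a set \<Rightarrow> real" where
  "hausdorff01 d A B =
    (if A = {} \<and> B = {} then 0
     else if A = {} \<or> B = {} then 1
     else LEAST t. 0 \<le> t \<and> t \<le> 1 \<and>
       (\<forall>r>t. (\<forall>x\<in>A. \<exists>y\<in>B. d x y < r) \<and> (\<forall>y\<in>B. \<exists>x\<in>A. d y x < r)))"

locale metric_set_structure = Metric_space M d
  for M :: "'a set" and d :: "'a \<Rightarrow> 'a \<Rightarrow> real" +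
  fixes E :: "'a \<Rightarrow> 'a \<Rightarrow> bool"
  assumes nonempty: "M \<noteq> {}"
    and complete: "mcomplete"
    and le_one: "\<And>x y. x \<in> M \<Longrightarrow> y \<in> M \<Longrightarrow> d x y \<le> 1"
    and E_in_M: "\<And>x y. E x y \<Longrightarrow> x \<in> M \<and> y \<in> M"
    and E_closed: "closedin (prod_topology mtopology mtopology) {(x, y). E x y}"
    and dist_eq_hausdorff:
      "\<And>a b. a \<in> M \<Longrightarrow> b \<in> M \<Longrightarrow> d a b = hausdorff01 d {x. E x a} {x. E x b}"

section \<open>Formulas and excision\<close>

(* Variables are natural numbers. SupB x y f and InfB x y f are the bounded quantifiers
   "sup over x E y" and "inf over x E y": they bind x, whereas y is not bound by them. *)
datatype mform =
    Unit
  | Dist nat nat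
  | Plus mform mform
  | MaxF mform mform
  | MinF mform mform
  | Scale real mform
  | SupF nat mform
  | InfF nat mform
  | SupB nat nat mform
  | InfB nat nat mform

primrec vbound :: "mform \<Rightarrow> real" where
  "vbound Unit = 1"
| "vbound (Dist x y) = 1"
| "vbound (Plus p q) = vbound p + vbound q"
| "vbound (MaxF p q) = max (vbound p) (vbound q)"
| "vbound (MinF p q) = max (vbound p) (vbound q)"
| "vbound (Scale r p) = \<bar>r\<bar> * vbound p"
| "vbound (SupF x p) = vbound p"
| "vbound (InfF x p) = vbound p"
| "vbound (SupB x y p) = vbound p"
| "vbound (InfB x y p) = vbound p"

(* Suprema and infima are over sets of reals that are nonempty and bounded by vbound
   (for assignments into M), so the total operators SUP and INF have their usual meaning. *)
primrec fval ::
  "'a set \<Rightarrow> ('a \<Rightarrow> 'a \<Rightarrow> real) \<Rightarrow> ('a \<Rightarrow> 'a \<Rightarrow> bool) \<Rightarrow> mform \<Rightarrow> (nat \<Rightarrow> 'a) \<Rightarrow> real"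
where
  "fval M d E Unit e = 1"
| "fval M d E (Dist x y) e = d (e x) (e y)"
| "fval M d E (Plus p q) e = fval M d E p e + fval M d E q e"
| "fval M d E (MaxF p q) e = max (fval M d E p e) (fval M d E q e)"
| "fval M d E (MinF p q) e = min (fval M d E p e) (fval M d E q e)"
| "fval M d E (Scale r p) e = r * fval M d E p e"
| "fval M d E (SupF x p) e = (SUP b\<in>M. fval M d E p (e(x := b)))"
| "fval M d E (InfF x p) e = (INF b\<in>M. fval M d E p (e(x := b)))"
| "fval M d E (SupB x y p) e =
    (if {b \<in> M. E b (e y)} = {} then - vbound p
     else SUP b\<in>{b \<in> M. E b (e y)}. fval M d E p (e(x := b)))"
| "fval M d E (InfB x y p) e =
    (if {b \<in> M. E b (e y)} = {} then vbound p
     else INF b\<in>{b \<in> M. E b (e y)}. fval M d E p (e(x := b)))"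

locale MSE_model = metric_set_structure +
  assumes excision:
    "\<And>p x e r s. range e \<subseteq> M \<Longrightarrow> r < s \<Longrightarrow>
      \<exists>b\<in>M. \<forall>c\<in>M.
        (fval M d E p (e(x := c)) \<le> r \<longrightarrow> E c b) \<and>
        (E c b \<longrightarrow> fval M d E p (e(x := c)) < s)"

section \<open>Sets inside a model\<close>

(* All quantifiers are relativised to M. The operations on sets are definite descriptions:
   in a metric set structure a set is determined by its elements, and the
   sets named below exist in models of MSE (for uniformly discrete a, where a occurs). *)
locale set_operations =
  fixes M :: "'a set" and E :: "'a \<Rightarrow> 'a \<Rightarrow> bool"
begin

definition elts :: "'a \<Rightarrow> 'a set" where
  "elts b = {x \<in> M. E x b}"

definition sub :: "'a \<Rightarrow> 'a \<Rightarrow> bool" where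
  "sub a b \<longleftrightarrow> (\<forall>x\<in>M. E x a \<longrightarrow> E x b)"

definition the_set :: "('a \<Rightarrow> bool) \<Rightarrow> 'a" where
  "the_set P = (THE z. z \<in> M \<and> (\<forall>x\<in>M. E x z \<longleftrightarrow> P x))"

definition empty :: 'a where
  "empty = the_set (\<lambda>z. False)"

definition upair :: "'a \<Rightarrow> 'a \<Rightarrow> 'a" where
  "upair x y = the_set (\<lambda>z. z = x \<or> z = y)"

definition single :: "'a \<Rightarrow> 'a" where
  "single x = upair x x"

definition opair :: "'a \<Rightarrow> 'a \<Rightarrow> 'a" where
  "opair x y = upair (upair (single x) empty) (single (single y))"

definition product :: "'a \<Rightarrow> 'a \<Rightarrow> 'a" where
  "product a b = the_set (\<lambda>z. \<exists>x\<in>M. \<exists>y\<in>M. E x a \<and> E y b \<and> z = opair x y)"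

definition powerset :: "'a \<Rightarrow> 'a" where
  "powerset a = the_set (\<lambda>c. sub c a)"

definition equinum :: "'a \<Rightarrow> 'a \<Rightarrow> 'a \<Rightarrow> bool" where
  "equinum a c f \<longleftrightarrow>
    (\<exists>g\<in>M. sub g (product a a) \<and>
      (\<exists>h. bij_betw h (elts c) (elts f) \<and> elts g = (\<lambda>x. opair x (h x)) ` elts c))"

definition cardinal :: "'a \<Rightarrow> 'a \<Rightarrow> 'a" where
  "cardinal a c = the_set (\<lambda>f. sub f a \<and> equinum a c f)"

definition succ :: "'a \<Rightarrow> 'a \<Rightarrow> 'a" where
  "succ a b = the_set (\<lambda>c. sub c a \<and>
    (\<exists>f\<in>M. E f b \<and> sub f c \<and> (\<exists>!g. g \<in> M \<and> E g c \<and> \<not> E g f)))"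

definition card_zero :: 'a where
  "card_zero = single empty"

definition inductive_in :: "'a \<Rightarrow> 'a \<Rightarrow> bool" where
  "inductive_in a y \<longleftrightarrow>
    sub y (powerset (powerset a)) \<and> E card_zero y \<and>
    (\<forall>x\<in>M. E x y \<longrightarrow> E (succ a x) y \<or> succ a x = empty)"

definition naturals :: "'a \<Rightarrow> 'a" where
  "naturals a = the_set (\<lambda>x. E x (powerset (powerset a)) \<and>
    (\<forall>y\<in>M. inductive_in a y \<longrightarrow> E x y))"

definition Infinite :: "'a \<Rightarrow> bool" where
  "Infinite a \<longleftrightarrow> \<not> E (cardinal a a) (naturals a)"

definition uniformly_discrete :: "('a \<Rightarrow> 'a \<Rightarrow> real) \<Rightarrow> 'a \<Rightarrow> bool" where
  "uniformly_discrete d a \<longleftrightarrow>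
    (\<exists>\<epsilon>>0. \<forall>x\<in>elts a. \<forall>y\<in>elts a. x \<noteq> y \<longrightarrow> \<epsilon> \<le> d x y)"

end

section \<open>Full arithmetic of order omega\<close>

(* Var n i is the i-th variable of sort n. *)
datatype aterm = Var nat nat | Zero | Succ aterm

primrec has_sort :: "aterm \<Rightarrow> nat \<Rightarrow> bool" where
  "has_sort (Var n i) m \<longleftrightarrow> m = n"
| "has_sort Zero m \<longleftrightarrow> m = 0"
| "has_sort (Succ t) m \<longleftrightarrow> m = 0 \<and> has_sort t 0"

(* Eq n and Mem n are equality on sort n and membership between the sorts n and n + 1;
   Forall n i quantifies over the i-th variable of sort n. *)
datatype aform =
    Eq nat aterm aterm
  | Mem nat aterm aterm
  | Neg aform
  | Conj aform aform
  | Forall nat nat aform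

primrec well_sorted :: "aform \<Rightarrow> bool" where
  "well_sorted (Eq n s t) \<longleftrightarrow> has_sort s n \<and> has_sort t n"
| "well_sorted (Mem n s t) \<longleftrightarrow> has_sort s n \<and> has_sort t (Suc n)"
| "well_sorted (Neg p) \<longleftrightarrow> well_sorted p"
| "well_sorted (Conj p q) \<longleftrightarrow> well_sorted p \<and> well_sorted q"
| "well_sorted (Forall n i p) \<longleftrightarrow> well_sorted p"

primrec tval :: "'a \<Rightarrow> ('a \<Rightarrow> 'a) \<Rightarrow> (nat \<Rightarrow> nat \<Rightarrow> 'a) \<Rightarrow> aterm \<Rightarrow> 'a" where
  "tval z S e (Var n i) = e n i"
| "tval z S e Zero = z"
| "tval z S e (Succ t) = S (tval z S e t)"

definition upd :: "(nat \<Rightarrow> nat \<Rightarrow> 'a) \<Rightarrow> nat \<Rightarrow> nat \<Rightarrow> 'a \<Rightarrow> (nat \<Rightarrow> nat \<Rightarrow> 'a)" where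
  "upd e n i x = e(n := (e n)(i := x))"

primrec sat ::
  "(nat \<Rightarrow> 'a set) \<Rightarrow> (nat \<Rightarrow> 'a \<Rightarrow> 'a \<Rightarrow> bool) \<Rightarrow> 'a \<Rightarrow> ('a \<Rightarrow> 'a) \<Rightarrow>
    aform \<Rightarrow> (nat \<Rightarrow> nat \<Rightarrow> 'a) \<Rightarrow> bool"
where
  "sat T mem z S (Eq n s t) e \<longleftrightarrow> tval z S e s = tval z S e t"
| "sat T mem z S (Mem n s t) e \<longleftrightarrow> mem n (tval z S e s) (tval z S e t)"
| "sat T mem z S (Neg p) e \<longleftrightarrow> \<not> sat T mem z S p e"
| "sat T mem z S (Conj p q) e \<longleftrightarrow> sat T mem z S p e \<and> sat T mem z S q e"
| "sat T mem z S (Forall n i p) e \<longleftrightarrow> (\<forall>x\<in>T n. sat T mem z S p (upd e n i x))"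

(* T n is the sort T_n and mem n the membership relation between T_n and T_(n+1).
   The carriers of different sorts may overlap, since variables and membership symbols carry
   their sort. Sorts are required to be nonempty, so that there are
   assignments e as in comprehension and that axiom is not vacuous. *)
locale full_omega_arithmetic =
  fixes T :: "nat \<Rightarrow> 'a set"
    and mem :: "nat \<Rightarrow> 'a \<Rightarrow> 'a \<Rightarrow> bool"
    and z :: 'a
    and S :: "'a \<Rightarrow> 'a"
  assumes sort_nonempty: "\<And>n. T n \<noteq> {}"
    and zero_sort: "z \<in> T 0"
    and succ_sort: "\<And>x. x \<in> T 0 \<Longrightarrow> S x \<in> T 0"
    and succ_inj: "inj_on S (T 0)"
    and zero_not_succ: "z \<notin> S ` T 0"
    and induction: "\<And>X. X \<in> T 1 \<Longrightarrow> mem 0 z X \<Longrightarrow>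
      (\<And>x. x \<in> T 0 \<Longrightarrow> mem 0 x X \<Longrightarrow> mem 0 (S x) X) \<Longrightarrow> (\<forall>x\<in>T 0. mem 0 x X)"
    and extensionality: "\<And>n X Y. X \<in> T (Suc n) \<Longrightarrow> Y \<in> T (Suc n) \<Longrightarrow>
      (\<And>x. x \<in> T n \<Longrightarrow> mem n x X \<longleftrightarrow> mem n x Y) \<Longrightarrow> X = Y"
    and comprehension: "\<And>n i p e. well_sorted p \<Longrightarrow> (\<And>m j. e m j \<in> T m) \<Longrightarrow>
      (\<exists>X\<in>T (Suc n). \<forall>x\<in>T n. mem n x X \<longleftrightarrow> sat T mem z S p (upd e n i x))"

end

theory Submission
  imports Defs
begin

text \<open>Excision only sandwiches a set between the sublevel sets of a formula, so an exact set has to be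
produced as a limit. If a formula \<open>\<phi>\<close> is nonpositive on a uniformly discrete \<open>F\<close> and small values of
\<open>\<phi>\<close> force closeness to \<open>F\<close>, then the sets excised at levels tending to 0 form a Cauchy sequence in the
Hausdorff metric, and its limit has exactly the elements \<open>F\<close> (\<open>exact_set\<close>). Two consequences carry
everything: a property of the elements of a uniformly discrete set has an exact extension as soon as
a formula separates it from its negation by a gap (\<open>separation\<close>), and a uniformly discrete set has a
power set, which is uniformly discrete with the same constant (\<open>powerset\<close>).

Iterating, all ranks \<open>a\<close>, \<open>\<P>(a)\<close>, \<open>\<P>(\<P>(a))\<close>, ... are uniformly discrete with one common \<open>\<epsilon>\<close>. On
them equality and membership are decided with a gap: \<open>d(x, y)\<close> is 0 or at least \<open>\<epsilon>\<close>, and so is the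
distance from \<open>x\<close> to a set \<open>y\<close> of the next rank. Gaps survive negation, conjunction and
quantification over a rank, so real-valued logic restricted to the ranks is classical
higher-order logic over \<open>a\<close>, and every such formula, with parameters, has full comprehension
(\<open>comprehension_A\<close>). The natural numbers lie in rank 2 and the \<open>n\<close>-th sort in rank \<open>n + 2\<close>. Hence
comprehension for the arithmetic structure follows by translating each arithmetical formula into a
definable predicate (\<open>definable_sat\<close>).

What remains is Frege's arithmetic inside this higher-order logic. The graph of a bijection between
subsets of \<open>a\<close> has rank 4, so equinumerosity and with it cardinals and successors are definable. The
set of all cardinals \<open>|c|\<close> is closed under successor in the sense that defines \<open>\<nat>\<close>, because
\<open>succ |c| = |c'|\<close> when \<open>c'\<close> has one more element (\<open>succ_cardinal\<close>). So every natural number is some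
\<open>|c|\<close> (\<open>natural_is_cardinal\<close>). Its successor can only be empty if \<open>c = a\<close>, which the infinity of \<open>a\<close>
excludes; injectivity of the successor comes from removing a point from an internal bijection
(\<open>equinum_remove_one\<close>).\<close>

locale mse = MSE_model M d E + set_operations M E
  for M :: "'a set" and d :: "'a \<Rightarrow> 'a \<Rightarrow> real" and E :: "'a \<Rightarrow> 'a \<Rightarrow> bool"

section \<open>The Hausdorff distance\<close>

text \<open>The infimum of the admissible radii is itself admissible, so \<open>LEAST\<close> selects it.\<close>
lemma hausdorff01_least:
  fixes d :: "'a \<Rightarrow> 'a \<Rightarrow> real"
  assumes ne: "A \<noteq> {}" "B \<noteq> {}"
    and le1: "\<And>x y. x \<in> A \<Longrightarrow> y \<in> B \<Longrightarrow> d x y \<le> 1 \<and> d y x \<le> 1"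
  defines "Q \<equiv> \<lambda>t. 0 \<le> t \<and> t \<le> 1 \<and>
       (\<forall>r>t. (\<forall>x\<in>A. \<exists>y\<in>B. d x y < r) \<and> (\<forall>y\<in>B. \<exists>x\<in>A. d y x < r))"
  shows "Q (hausdorff01 d A B)" and "Q t \<Longrightarrow> hausdorff01 d A B \<le> t"
proof -
  define h where "h = Inf (Collect Q)"
  have Q1: "Q 1"
    using ne le1 unfolding Q_def by (auto, meson ex_in_conv order_le_less_trans,
        meson ex_in_conv order_le_less_trans)
  have bdd: "bdd_below (Collect Q)"
    by (rule bdd_belowI[of _ 0]) (auto simp: Q_def)
  have low: "h \<le> t" if "Q t" for t
    unfolding h_def using that bdd by (simp add: cInf_lower)
  have ge0: "0 \<le> h"
    unfolding h_def using Q1 by (intro cInf_greatest) (auto simp: Q_def)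
  have near: "\<exists>t. Q t \<and> t < r" if "h < r" for r
    using cInf_lessD[of "Collect Q" r] Q1 that unfolding h_def by blast
  have Qh: "Q h"
    unfolding Q_def
  proof (intro conjI allI impI)
    show "0 \<le> h" by (rule ge0)
    show "h \<le> 1" by (rule low[OF Q1])
    fix r assume "h < r"
    then obtain t where "Q t" "t < r" using near by blast
    then show "\<forall>x\<in>A. \<exists>y\<in>B. d x y < r" "\<forall>y\<in>B. \<exists>x\<in>A. d y x < r"
      unfolding Q_def by blast+
  qed
  have "hausdorff01 d A B = Least Q"
    unfolding hausdorff01_def Q_def using ne by simp
  also have "Least Q = h"
    by (rule Least_equality) (use Qh low in auto)
  finally have eq: "hausdorff01 d A B = h" .
  show "Q (hausdorff01 d A B)" using Qh eq by simp
  show "Q t \<Longrightarrow> hausdorff01 d A B \<le> t" using low eq by simp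
qed

context mse
begin

lemma elts_subset: "elts b \<subseteq> M"
  by (auto simp: elts_def)

lemma in_elts_iff [simp]: "x \<in> elts b \<longleftrightarrow> E x b"
  using E_in_M by (auto simp: elts_def)

lemma sub_iff: "sub x y \<longleftrightarrow> elts x \<subseteq> elts y"
  using E_in_M by (auto simp: sub_def)

lemma dist_elts:
  assumes "x \<in> M" "y \<in> M" shows "d x y = hausdorff01 d (elts x) (elts y)"
  using dist_eq_hausdorff[OF assms] E_in_M
  by (metis (no_types, lifting) Collect_cong elts_def)

text \<open>The bound \<open>r \<le> 1\<close> excludes the conventional distance 1 between the empty set and a nonempty one.\<close>
lemma dist_less_match:
  assumes "x \<in> M" "y \<in> M" "d x y < r" "r \<le> 1" "E u x"
  shows "\<exists>v. E v y \<and> d u v < r"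
proof -
  have h: "hausdorff01 d (elts x) (elts y) < r" using dist_elts assms by simp
  have ne: "elts x \<noteq> {}" using assms(5) in_elts_iff by blast
  then have ne': "elts y \<noteq> {}" using h assms(4) by (auto simp: hausdorff01_def)
  have le: "d u v \<le> 1 \<and> d v u \<le> 1" if "u \<in> elts x" "v \<in> elts y" for u v
    using le_one that elts_subset by blast
  have "\<forall>u\<in>elts x. \<exists>v\<in>elts y. d u v < r"
    using hausdorff01_least(1)[of "elts x" "elts y" d, OF ne ne' le] h by blast
  then show ?thesis using assms(5) by (metis in_elts_iff)
qed

lemma dist_le_match:
  assumes "x \<in> M" "y \<in> M" "0 \<le> t" "t \<le> 1"
    and "\<And>u. E u x \<Longrightarrow> \<exists>v. E v y \<and> d u v \<le> t"
    and "\<And>v. E v y \<Longrightarrow> \<exists>u. E u x \<and> d u v \<le> t"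
  shows "d x y \<le> t"
proof (cases "elts x = {} \<or> elts y = {}")
  case True
  then have "elts x = {}" "elts y = {}" using assms(5,6) in_elts_iff by blast+
  then show ?thesis using dist_elts[OF assms(1,2)] assms(3) by (simp add: hausdorff01_def)
next
  case False
  have "hausdorff01 d (elts x) (elts y) \<le> t"
  proof (rule hausdorff01_least(2))
    show "0 \<le> t \<and> t \<le> 1 \<and> (\<forall>r>t. (\<forall>x\<in>elts x. \<exists>y\<in>elts y. d x y < r) \<and>
      (\<forall>y\<in>elts y. \<exists>x\<in>elts x. d y x < r))"
      using assms(3-6) by (metis in_elts_iff commute order_le_less_trans)
  qed (use False le_one E_in_M in_elts_iff in blast)+
  then show ?thesis using dist_elts assms by simp
qed

text \<open>Equal sets of elements have Hausdorff distance 0.\<close>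
lemma extensional:
  assumes "x \<in> M" "y \<in> M" "\<And>z. E z x \<longleftrightarrow> E z y" shows "x = y"
proof -
  have "d x y \<le> 0"
  proof (rule dist_le_match[OF assms(1,2)])
    show "\<exists>v. E v y \<and> d u v \<le> 0" if "E u x" for u
      using that assms(3) E_in_M by (intro exI[of _ u]) auto
    show "\<exists>u. E u x \<and> d u v \<le> 0" if "E v y" for v
      using that assms(3) E_in_M by (intro exI[of _ v]) auto
  qed auto
  then show ?thesis using assms zero nonneg by (metis order_antisym)
qed

lemma the_set_eq:
  assumes "b \<in> M" "\<And>x. x \<in> M \<Longrightarrow> E x b \<longleftrightarrow> P x"
  shows "the_set P = b"
  unfolding the_set_def
proof (rule the_equality)
  fix z assume "z \<in> M \<and> (\<forall>x\<in>M. E x z = P x)"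
  then show "z = b" using assms E_in_M by (intro extensional) blast+
qed (use assms in auto)

lemma E_closed_right:
  assumes "limitin mtopology b l sequentially" "\<And>n. E x (b n)"
  shows "E x l"
proof -
  have x: "x \<in> M" using assms(2) E_in_M by blast
  have "continuous_map mtopology (prod_topology mtopology mtopology) (\<lambda>y. (x, y))"
    using x by (intro continuous_map_pairedI) auto
  then have "closedin mtopology {y \<in> topspace mtopology. (x, y) \<in> {(x, y). E x y}}"
    using E_closed by (rule closedin_continuous_map_preimage)
  moreover have "{y \<in> topspace mtopology. (x, y) \<in> {(x, y). E x y}} = {y \<in> M. E x y}" by simp
  ultimately have c: "closedin mtopology {y \<in> M. E x y}" by simp
  have "range b \<subseteq> {y \<in> M. E x y}" using assms(2) E_in_M by auto
  then have "l \<in> {y \<in> M. E x y}"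
    using c assms(1) unfolding metric_closedin_iff_sequentially_closed by blast
  then show ?thesis by simp
qed

section \<open>Values of formulas\<close>

lemma vbound_nonneg: "0 \<le> vbound p"
  by (induction p) auto

text \<open>This makes every supremum and infimum in the semantics a bounded one; the values chosen for bounded
quantifiers over the empty set are the extreme ones that the bound allows.\<close>
lemma fval_bound: "range e \<subseteq> M \<Longrightarrow> \<bar>fval M d E p e\<bar> \<le> vbound p"
proof (induction p arbitrary: e)
  case (Dist x y)
  then have "e x \<in> M" "e y \<in> M" by auto
  then show ?case using le_one nonneg by simp
next
  case (Plus p q)
  then have "\<bar>fval M d E p e\<bar> \<le> vbound p" "\<bar>fval M d E q e\<bar> \<le> vbound q" by blast+
  then show ?case by (simp add: abs_le_iff)
next
  case (MaxF p q)
  then have "\<bar>fval M d E p e\<bar> \<le> vbound p" "\<bar>fval M d E q e\<bar> \<le> vbound q" by blast+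
  then show ?case by (auto simp: abs_le_iff max_def)
next
  case (MinF p q)
  then have "\<bar>fval M d E p e\<bar> \<le> vbound p" "\<bar>fval M d E q e\<bar> \<le> vbound q" by blast+
  then show ?case by (auto simp: abs_le_iff min_def max_def)
next
  case (Scale r p)
  then show ?case by (simp add: abs_mult mult_left_mono)
next
  case (SupF x p)
  have b: "\<bar>fval M d E p (e(x := b))\<bar> \<le> vbound p" if "b \<in> M" for b
    using SupF that by (simp add: image_subset_iff)
  show ?case using nonempty b by (auto intro!: cSup_abs_le)
next
  case (InfF x p)
  have b: "\<bar>fval M d E p (e(x := b))\<bar> \<le> vbound p" if "b \<in> M" for b
    using InfF that by (simp add: image_subset_iff)
  show ?case using nonempty b by (auto intro!: cInf_abs_ge)
next
  case (SupB x y p)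
  have b: "\<bar>fval M d E p (e(x := b))\<bar> \<le> vbound p" if "b \<in> M" for b
    using SupB that by (simp add: image_subset_iff)
  show ?case using b vbound_nonneg[of p] by (auto intro!: cSup_abs_le)
next
  case (InfB x y p)
  have b: "\<bar>fval M d E p (e(x := b))\<bar> \<le> vbound p" if "b \<in> M" for b
    using InfB that by (simp add: image_subset_iff)
  show ?case using b vbound_nonneg[of p] by (auto intro!: cInf_abs_ge)
qed auto

lemma range_upd: "range e \<subseteq> M \<Longrightarrow> c \<in> M \<Longrightarrow> range (e(v := c)) \<subseteq> M"
  by auto

lemma SupB_le:
  assumes "range e \<subseteq> M" "0 \<le> t" "\<And>b. E b (e y) \<Longrightarrow> fval M d E p (e(x := b)) \<le> t"
  shows "fval M d E (SupB x y p) e \<le> t"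
  using assms vbound_nonneg[of p] by (auto intro!: cSUP_least)

lemma SupB_ge:
  assumes "range e \<subseteq> M" "E b (e y)"
  shows "fval M d E p (e(x := b)) \<le> fval M d E (SupB x y p) e"
proof -
  have "b \<in> M" using assms E_in_M by blast
  moreover have "bdd_above ((\<lambda>b. fval M d E p (e(x := b))) ` {b \<in> M. E b (e y)})"
  proof (rule bdd_aboveI2)
    fix b assume "b \<in> {b \<in> M. E b (e y)}"
    then show "fval M d E p (e(x := b)) \<le> vbound p"
      using fval_bound[of "e(x := b)" p] range_upd[OF assms(1)] by fastforce
  qed
  ultimately have "fval M d E p (e(x := b)) \<le> (SUP b\<in>{b \<in> M. E b (e y)}. fval M d E p (e(x := b)))"
    using assms(2) by (intro cSUP_upper) auto
  moreover have "{b \<in> M. E b (e y)} \<noteq> {}" using \<open>b \<in> M\<close> assms(2) by blast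
  ultimately show ?thesis by (simp only: fval.simps if_False)
qed

lemma InfB_less:
  assumes "fval M d E (InfB x y p) e < t" "t \<le> 1" "1 \<le> vbound p"
  shows "\<exists>b. E b (e y) \<and> fval M d E p (e(x := b)) < t"
proof (rule ccontr)
  assume no: "\<not> ?thesis"
  then have "t \<le> fval M d E (InfB x y p) e"
    using assms(2,3) by (auto simp: not_less intro!: cINF_greatest)
  then show False using assms(1) by simp
qed

lemma InfB_le:
  assumes "range e \<subseteq> M" "E b (e y)"
  shows "fval M d E (InfB x y p) e \<le> fval M d E p (e(x := b))"
proof -
  have "b \<in> M" using assms E_in_M by blast
  moreover have "bdd_below ((\<lambda>b. fval M d E p (e(x := b))) ` {b \<in> M. E b (e y)})"
  proof (rule bdd_belowI2)
    fix b assume "b \<in> {b \<in> M. E b (e y)}"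
    then show "- vbound p \<le> fval M d E p (e(x := b))"
      using fval_bound[of "e(x := b)" p] range_upd[OF assms(1)] by fastforce
  qed
  ultimately have "(INF b\<in>{b \<in> M. E b (e y)}. fval M d E p (e(x := b))) \<le> fval M d E p (e(x := b))"
    using assms(2) by (intro cINF_lower) auto
  moreover have "{b \<in> M. E b (e y)} \<noteq> {}" using \<open>b \<in> M\<close> assms(2) by blast
  ultimately show ?thesis by (simp only: fval.simps if_False)
qed

section \<open>Exact sets from excision\<close>

text \<open>Uniform discreteness, written so that it applies directly to strict bounds on distances. It is used
for external sets of points as well as for the elements of a point of the model.\<close>
definition separated :: "real \<Rightarrow> 'a set \<Rightarrow> bool" where
  "separated \<epsilon> F \<longleftrightarrow> F \<subseteq> M \<and> (\<forall>x\<in>F. \<forall>y\<in>F. d x y < \<epsilon> \<longrightarrow> x = y)"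

lemma separated_subset: "separated \<epsilon> F \<Longrightarrow> G \<subseteq> F \<Longrightarrow> separated \<epsilon> G"
  unfolding separated_def by (meson order_trans subsetD)

lemma separated_closed:
  assumes F: "separated \<epsilon> F" "0 < \<epsilon>" and x: "x \<in> M"
    and near: "\<And>\<delta>. 0 < \<delta> \<Longrightarrow> \<exists>y\<in>F. d x y < \<delta>"
  shows "x \<in> F"
proof -
  obtain y where y: "y \<in> F" "d x y < \<epsilon> / 2" using near[of "\<epsilon> / 2"] F(2) by auto
  have "x = y"
  proof (rule ccontr)
    assume "x \<noteq> y"
    have yM: "y \<in> M" using y F by (auto simp: separated_def)
    then have "0 < d x y" using \<open>x \<noteq> y\<close> x by simp
    then obtain z where z: "z \<in> F" "d x z < min (d x y) (\<epsilon> / 2)"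
      using near[of "min (d x y) (\<epsilon> / 2)"] F(2) by auto
    have zM: "z \<in> M" using z F by (auto simp: separated_def)
    have "d y z \<le> d y x + d x z" using triangle x yM zM by blast
    then have "d y z < \<epsilon>" using y(2) z(2) commute[of x y] by simp
    then have "y = z" using F(1) y(1) z(1) unfolding separated_def by blast
    then show False using z(2) by simp
  qed
  then show ?thesis using y by simp
qed

text \<open>Excising at thresholds tending to 0 gives points whose element sets contain \<open>F\<close> and lie in ever
smaller neighbourhoods of \<open>F\<close>. They are Cauchy for the Hausdorff distance, and completeness provides
a limit. It contains \<open>F\<close> because the membership relation is closed, and nothing else because \<open>F\<close> is
closed.\<close>
lemma exact_set:
  assumes F: "separated \<epsilon> F" "0 < \<epsilon>" and e: "range e \<subseteq> M"
    and on: "\<And>c. c \<in> F \<Longrightarrow> fval M d E p (e(v := c)) \<le> 0"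
    and near: "\<And>\<delta>. 0 < \<delta> \<Longrightarrow> \<exists>s>0. \<forall>c\<in>M. fval M d E p (e(v := c)) < s \<longrightarrow> (\<exists>y\<in>F. d c y < \<delta>)"
  shows "\<exists>b\<in>M. elts b = F"
proof -
  have FM: "F \<subseteq> M" using F by (simp add: separated_def)
  define \<delta> where "\<delta> = (\<lambda>n. inverse (real (Suc n)))"
  have \<delta>: "0 < \<delta> n" "\<delta> n \<le> 1" for n by (auto simp: \<delta>_def field_simps)
  have \<delta>_anti: "\<delta> n \<le> \<delta> k" if "k \<le> n" for k n
    using that by (simp add: \<delta>_def)
  have \<delta>_small: "\<exists>k. \<delta> k < r" if "0 < r" for r
    using reals_Archimedean[OF that] by (simp add: \<delta>_def)
  have "\<exists>b\<in>M. F \<subseteq> elts b \<and> (\<forall>c\<in>elts b. \<exists>y\<in>F. d c y < \<delta> n)" for n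
  proof -
    obtain s where s: "s > 0" "\<forall>c\<in>M. fval M d E p (e(v := c)) < s \<longrightarrow> (\<exists>y\<in>F. d c y < \<delta> n)"
      using near[OF \<delta>(1)] by blast
    obtain b where b: "b \<in> M" "\<forall>c\<in>M. (fval M d E p (e(v := c)) \<le> 0 \<longrightarrow> E c b) \<and>
        (E c b \<longrightarrow> fval M d E p (e(v := c)) < s)"
      using excision[OF e s(1)] by blast
    show ?thesis
    proof (intro bexI[OF _ b(1)] conjI)
      show "F \<subseteq> elts b" using b(2) on FM by auto
      show "\<forall>c\<in>elts b. \<exists>y\<in>F. d c y < \<delta> n" using b(2) s(2) elts_subset[of b] by auto
    qed
  qed
  then obtain b where bM: "\<And>n. b n \<in> M" and Fb: "\<And>n. F \<subseteq> elts (b n)"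
    and bn: "\<And>n c. E c (b n) \<Longrightarrow> \<exists>y\<in>F. d c y < \<delta> n"
    unfolding in_elts_iff Ball_def by metis
  have dist_b: "d (b m) (b n) \<le> \<delta> k" if "k \<le> m" "k \<le> n" for k m n
  proof (rule dist_le_match[OF bM bM])
    show "0 \<le> \<delta> k" "\<delta> k \<le> 1" using \<delta>[of k] by auto
    fix u
    show "E u (b m) \<Longrightarrow> \<exists>v. E v (b n) \<and> d u v \<le> \<delta> k"
      using bn[of u m] Fb[of n] \<delta>_anti[OF that(1)] by (meson in_elts_iff less_imp_le order_trans subsetD)
    show "E u (b n) \<Longrightarrow> \<exists>v. E v (b m) \<and> d v u \<le> \<delta> k"
      using bn[of u n] Fb[of m] \<delta>_anti[OF that(2)] commute
      by (metis in_elts_iff less_imp_le order_trans subsetD)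
  qed
  have "MCauchy b"
    unfolding MCauchy_def
  proof (intro conjI allI impI)
    show "range b \<subseteq> M" using bM by auto
    fix r :: real assume "0 < r"
    then obtain k where "\<delta> k < r" using \<delta>_small by blast
    then show "\<exists>N. \<forall>n n'. N \<le> n \<longrightarrow> N \<le> n' \<longrightarrow> d (b n) (b n') < r"
      using dist_b order_le_less_trans by blast
  qed
  then obtain l where l: "limitin mtopology b l sequentially"
    using complete unfolding mcomplete_def by blast
  have lM: "l \<in> M" using l limitin_mspace by blast
  have "elts l = F"
  proof
    show "F \<subseteq> elts l" using E_closed_right[OF l] Fb by (auto simp: subset_iff)
    show "elts l \<subseteq> F"
    proof
      fix x assume "x \<in> elts l"
      then have x: "E x l" and xM: "x \<in> M" using E_in_M by auto
      show "x \<in> F"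
      proof (rule separated_closed[OF F xM])
        fix r :: real assume r: "0 < r"
        obtain k where k: "\<delta> k < r / 2" using \<delta>_small[of "r/2"] r by auto
        define t where "t = min 1 (r / 2)"
        have t: "0 < t" "t \<le> 1" using r by (auto simp: t_def)
        obtain N where N: "\<And>n. N \<le> n \<Longrightarrow> d (b n) l < t"
          using l t(1) unfolding limit_metric_sequentially by blast
        define n where "n = max N k"
        have "d l (b n) < t" using N[of n] commute by (simp add: n_def)
        then obtain u where u: "E u (b n)" "d x u < t"
          using dist_less_match[OF lM bM _ t(2) x] by blast
        obtain y where y: "y \<in> F" "d u y < \<delta> n" using bn[OF u(1)] by blast
        have "u \<in> M" "y \<in> M" using u E_in_M y FM by auto
        then have "d x y \<le> d x u + d u y" using triangle xM by blast
        moreover have "\<delta> n \<le> \<delta> k" by (rule \<delta>_anti) (simp add: n_def)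
        ultimately have "d x y < r" using u(2) y(2) k by (simp add: t_def)
        then show "\<exists>y\<in>F. d x y < r" using y by blast
      qed
    qed
  qed
  then show ?thesis using lM by blast
qed

text \<open>The formula \<open>inf\<^sub>y max (d(w, y), p(y))\<close>, with \<open>y\<close> ranging over \<open>u\<close>, is, where
below 1, the distance from \<open>w\<close> to the elements of \<open>u\<close> with \<open>P\<close>. The hypotheses on \<open>p\<close> are required
for every value of \<open>w\<close>; this is how the freshness of \<open>w\<close> for \<open>p\<close> is expressed semantically.\<close>
lemma separation:
  assumes u: "separated \<epsilon> (elts u)" "0 < \<epsilon>" and e: "range e \<subseteq> M"
    and k: "e k = u" "k \<noteq> w" and v: "v \<noteq> w"
    and yes: "\<And>c y. c \<in> M \<Longrightarrow> E y u \<Longrightarrow> P y \<Longrightarrow> fval M d E p (e(w := c, v := y)) \<le> 0"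
    and no: "\<And>c y. c \<in> M \<Longrightarrow> E y u \<Longrightarrow> \<not> P y \<Longrightarrow> 1 \<le> fval M d E p (e(w := c, v := y))"
  shows "\<exists>b\<in>M. elts b = {y \<in> elts u. P y}"
proof (rule exact_set)
  let ?p = "InfB v k (MaxF (Dist w v) p)"
  show "separated \<epsilon> {y \<in> elts u. P y}" using u(1) by (rule separated_subset) auto
  show "fval M d E ?p (e(w := c)) \<le> 0" if "c \<in> {y \<in> elts u. P y}" for c
  proof -
    have c: "E c u" "P c" "c \<in> M" using that E_in_M by auto
    have "fval M d E ?p (e(w := c)) \<le> fval M d E (MaxF (Dist w v) p) (e(w := c, v := c))"
      by (rule InfB_le) (use c k v range_upd[OF e c(3)] in auto)
    also have "\<dots> \<le> 0" using yes[OF c(3) c(1,2)] v c(3) by simp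
    finally show ?thesis .
  qed
  show "\<exists>s>0. \<forall>c\<in>M. fval M d E ?p (e(w := c)) < s \<longrightarrow> (\<exists>y\<in>{y \<in> elts u. P y}. d c y < \<delta>)"
    if "0 < \<delta>" for \<delta>
  proof (intro exI[of _ "min 1 \<delta>"] conjI ballI impI)
    show "0 < min 1 \<delta>" using that by simp
    fix c assume c: "c \<in> M" and lt: "fval M d E ?p (e(w := c)) < min 1 \<delta>"
    obtain y where y: "E y ((e(w := c)) k)"
      "fval M d E (MaxF (Dist w v) p) ((e(w := c))(v := y)) < min 1 \<delta>"
      using InfB_less[OF lt] by auto
    have yu: "E y u" using y(1) k by simp
    have "d c y < \<delta>" "fval M d E p (e(w := c, v := y)) < 1" using y(2) v by auto
    moreover from this have "P y" using no[OF c yu] by (meson not_less)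
    ultimately show "\<exists>y\<in>{y \<in> elts u. P y}. d c y < \<delta>" using yu by (intro bexI[of _ y]) simp_all
  qed
qed (rule u(2), rule e)

lemma separated_Pow:
  assumes "separated \<epsilon> F" "\<epsilon> \<le> 1"
  shows "separated \<epsilon> {c \<in> M. elts c \<subseteq> F}"
  unfolding separated_def
proof (intro conjI ballI impI)
  fix x y assume x: "x \<in> {c \<in> M. elts c \<subseteq> F}" and y: "y \<in> {c \<in> M. elts c \<subseteq> F}" and lt: "d x y < \<epsilon>"
  have half: "E z y'" if "x' \<in> M" "y' \<in> M" "elts x' \<subseteq> F" "elts y' \<subseteq> F" "d x' y' < \<epsilon>" "E z x'" for x' y' z
  proof -
    have "\<exists>v. E v y' \<and> d z v < \<epsilon>" by (rule dist_less_match[OF that(1,2,5) assms(2) that(6)])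
    then obtain v where v: "E v y'" "d z v < \<epsilon>" by blast
    have "z \<in> F" "v \<in> F" using that v(1) by (auto simp: subset_iff)
    then have "z = v" using v(2) assms(1) unfolding separated_def by blast
    then show ?thesis using v(1) by simp
  qed
  show "x = y"
  proof (rule extensional)
    fix z
    have "d y x < \<epsilon>" using lt commute[of x y] by simp
    then show "E z x \<longleftrightarrow> E z y" using x y lt half[of x y z] half[of y x z] by blast
  qed (use x y in auto)
qed auto

text \<open>The excess \<open>sup\<^sub>z inf\<^sub>y d(z, y)\<close> of \<open>c\<close> over \<open>u\<close> (\<open>z\<close> in \<open>c\<close>, \<open>y\<close> in \<open>u\<close>) measures failure of inclusion.
If it is below some \<open>s \<le> \<epsilon> / 4\<close>, then \<open>c\<close> is close to a subset of \<open>u\<close>, namely to the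
set of points of \<open>u\<close> near \<open>c\<close>. That set exists by separation: the distance from a point of \<open>u\<close> to \<open>c\<close> is
either below \<open>s\<close> or at least half of \<open>\<epsilon>\<close>.\<close>
lemma powerset_exists:
  assumes u: "separated \<epsilon> (elts u)" "0 < \<epsilon>" "\<epsilon> \<le> 1" "u \<in> M"
  shows "\<exists>b\<in>M. elts b = {c \<in> M. elts c \<subseteq> elts u}"
proof (rule exact_set)
  let ?q = "InfB 2 3 (Dist 1 2)"
  let ?p = "SupB 1 0 ?q"
  let ?e = "\<lambda>n::nat. u"
  show "separated \<epsilon> {c \<in> M. elts c \<subseteq> elts u}" using separated_Pow u by blast
  show "0 < \<epsilon>" by fact
  show "range ?e \<subseteq> M" using u by auto
  show "fval M d E ?p (?e(0 := c)) \<le> 0" if "c \<in> {c \<in> M. elts c \<subseteq> elts u}" for c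
  proof (rule SupB_le)
    show "range (?e(0 := c)) \<subseteq> M" using that u by auto
    fix z assume z: "E z ((?e(0 := c)) 0)"
    then have zu: "E z u" and zM: "z \<in> M" using that E_in_M by (auto simp: subset_iff)
    have "fval M d E ?q (?e(0 := c, 1 := z)) \<le> fval M d E (Dist 1 2) (?e(0 := c, 1 := z, 2 := z))"
      by (rule InfB_le) (use zu zM that u in auto)
    also have "\<dots> = 0" using zM by simp
    finally show "fval M d E ?q (?e(0 := c, 1 := z)) \<le> 0" .
  qed simp
  show "\<exists>s>0. \<forall>c\<in>M. fval M d E ?p (?e(0 := c)) < s \<longrightarrow>
      (\<exists>y\<in>{c \<in> M. elts c \<subseteq> elts u}. d c y < \<delta>)" if "0 < \<delta>" for \<delta>
  proof (intro exI[of _ "min (\<delta> / 2) (\<epsilon> / 4)"] conjI ballI impI)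
    define s where "s = min (\<delta> / 2) (\<epsilon> / 4)"
    have s: "0 < s" "s < \<delta>" "s \<le> \<epsilon> / 4" "s \<le> 1" using that u by (auto simp: s_def)
    then show "0 < min (\<delta> / 2) (\<epsilon> / 4)" by (simp add: s_def)
    fix c assume c: "c \<in> M" and lt: "fval M d E ?p (?e(0 := c)) < min (\<delta> / 2) (\<epsilon> / 4)"
    have near: "\<exists>y. E y u \<and> d z y < s" if "E z c" for z
    proof -
      have "fval M d E ?q (?e(0 := c, 1 := z)) \<le> fval M d E ?p (?e(0 := c))"
        by (rule SupB_ge) (use c u that in auto)
      then have "fval M d E ?q (?e(0 := c, 1 := z)) < s" using lt by (simp add: s_def)
      from InfB_less[OF this s(4)] show ?thesis by auto
    qed
    define P where "P y \<longleftrightarrow> (\<exists>z. E z c \<and> d y z < s)" for y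
    \<comment> \<open>Rescaled so that distances up to a quarter of \<open>\<epsilon>\<close> become nonpositive and those from half of \<open>\<epsilon>\<close> on at least 1.\<close>
    let ?r = "Plus (Scale (4 / \<epsilon>) (InfB 2 4 (Dist 1 2))) (Scale (-1) Unit)"
    have "\<exists>b\<in>M. elts b = {y \<in> elts u. P y}"
    proof (rule separation[of \<epsilon> u "?e(4 := c)" 3 0 1])
      show "range (?e(4 := c)) \<subseteq> M" using c u by auto
      fix x y assume x: "x \<in> M" and y: "E y u"
      let ?f = "?e(4 := c, 0 := x, 1 := y)"
      have yM: "y \<in> M" using y E_in_M by blast
      have f: "range ?f \<subseteq> M" using c u x yM by auto
      {
        assume "P y"
        then obtain z where z: "E z c" "d y z < s" unfolding P_def by blast
        have "fval M d E (InfB 2 4 (Dist 1 2)) ?f \<le> fval M d E (Dist 1 2) (?f(2 := z))"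
          by (rule InfB_le[OF f]) (use z in auto)
        then have "fval M d E (InfB 2 4 (Dist 1 2)) ?f \<le> \<epsilon> / 4" using z s by simp
        then have "4 / \<epsilon> * fval M d E (InfB 2 4 (Dist 1 2)) ?f \<le> 4 / \<epsilon> * (\<epsilon> / 4)"
          using u(2) by (intro mult_left_mono) auto
        then show "fval M d E ?r ?f \<le> 0" using u(2) by simp
      next
        assume nP: "\<not> P y"
        have "\<epsilon> / 2 \<le> fval M d E (InfB 2 4 (Dist 1 2)) ?f"
        proof (rule ccontr)
          assume "\<not> ?thesis"
          then have "fval M d E (InfB 2 4 (Dist 1 2)) ?f < \<epsilon> / 2" by simp
          from InfB_less[OF this] u(3) obtain z where z: "E z c" "d y z < \<epsilon> / 2" by auto
          obtain y' where y': "E y' u" "d z y' < s" using near[OF z(1)] by blast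
          have M: "z \<in> M" "y' \<in> M" using z y' E_in_M by auto
          have "d y y' \<le> d y z + d z y'" using triangle M yM by blast
          then have "d y y' < \<epsilon>" using z y' s u by linarith
          then have "y = y'" using u(1) y y'(1) unfolding separated_def by (metis in_elts_iff)
          then show False using nP z(1) y'(2) commute[of z y] unfolding P_def by auto
        qed
        then have "4 / \<epsilon> * (\<epsilon> / 2) \<le> 4 / \<epsilon> * fval M d E (InfB 2 4 (Dist 1 2)) ?f"
          using u(2) by (intro mult_left_mono) auto
        then show "1 \<le> fval M d E ?r ?f" using u(2) by simp
      }
    qed (use u in auto)
    then obtain b where b: "b \<in> M" "elts b = {y \<in> elts u. P y}" by blast
    have Eb: "E y b \<longleftrightarrow> E y u \<and> P y" for y using b(2) in_elts_iff by blast
    have "d c b \<le> s"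
    proof (rule dist_le_match[OF c b(1)])
      show "0 \<le> s" "s \<le> 1" using s by auto
      show "\<exists>v. E v b \<and> d z v \<le> s" if "E z c" for z
      proof -
        obtain y where y: "E y u" "d z y < s" using near[OF \<open>E z c\<close>] by blast
        then have "P y" using \<open>E z c\<close> commute[of z y] unfolding P_def by auto
        then show ?thesis using y Eb by (intro exI[of _ y]) simp
      qed
      show "\<exists>z. E z c \<and> d z v \<le> s" if "E v b" for v
      proof -
        obtain z where "E z c" "d v z < s" using \<open>E v b\<close> unfolding Eb P_def by blast
        then show ?thesis using commute[of z v] by (intro exI[of _ z]) simp
      qed
    qed
    then have "d c b < \<delta>" using s by linarith
    moreover have "b \<in> {c \<in> M. elts c \<subseteq> elts u}" using b by blast
    ultimately show "\<exists>y\<in>{c \<in> M. elts c \<subseteq> elts u}. d c y < \<delta>" by blast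
  qed
qed

lemma powerset:
  assumes u: "separated \<epsilon> (elts u)" "0 < \<epsilon>" "\<epsilon> \<le> 1" "u \<in> M"
  shows "powerset u \<in> M" "elts (powerset u) = {c \<in> M. elts c \<subseteq> elts u}"
    "separated \<epsilon> (elts (powerset u))"
proof -
  obtain b where b: "b \<in> M" "elts b = {c \<in> M. elts c \<subseteq> elts u}"
    using powerset_exists[OF u] by blast
  have "powerset u = b" unfolding powerset_def
  proof (rule the_set_eq[OF b(1)])
    fix x assume "x \<in> M"
    then have "x \<in> elts b \<longleftrightarrow> elts x \<subseteq> elts u" unfolding b(2) by simp
    then show "E x b \<longleftrightarrow> sub x u" unfolding sub_iff in_elts_iff .
  qed
  then show "powerset u \<in> M" "elts (powerset u) = {c \<in> M. elts c \<subseteq> elts u}"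
    "separated \<epsilon> (elts (powerset u))"
    using b separated_Pow[OF u(1,3)] by (simp_all only:)
qed

end

section \<open>Definability over the ranks of a discrete set\<close>

text \<open>Ranks are kept in successor form so that the rule for membership between consecutive ranks
applies by unification.\<close>
abbreviation "r1 \<equiv> Suc 0"
abbreviation "r2 \<equiv> Suc r1"
abbreviation "r3 \<equiv> Suc r2"
abbreviation "r4 \<equiv> Suc r3"

locale discrete_set = mse +
  fixes a :: 'a and \<epsilon> :: real
  assumes a_in_M: "a \<in> M"
    and a_separated: "separated \<epsilon> (elts a)"
    and eps: "0 < \<epsilon>" "\<epsilon> \<le> 1"
begin

definition rank :: "nat \<Rightarrow> 'a" where
  "rank n = (powerset ^^ n) a"

abbreviation A :: "nat \<Rightarrow> 'a set" where
  "A n \<equiv> elts (rank n)"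

lemma iterated_powerset:
  assumes "u \<in> M" "separated \<epsilon> (elts u)"
  shows "(powerset ^^ n) u \<in> M" "separated \<epsilon> (elts ((powerset ^^ n) u))"
  using assms by (induction n) (simp_all add: powerset(1,3)[of \<epsilon>] eps)

lemma elts_iterated_powerset:
  assumes "u \<in> M" "separated \<epsilon> (elts u)"
  shows "elts ((powerset ^^ Suc n) u) = {c \<in> M. elts c \<subseteq> elts ((powerset ^^ n) u)}"
  using powerset(2)[OF iterated_powerset(2)[OF assms] eps iterated_powerset(1)[OF assms]] by simp

lemma rank_in_M: "rank n \<in> M"
  unfolding rank_def using iterated_powerset(1) a_in_M a_separated by blast

lemma rank_separated: "separated \<epsilon> (A n)"
  unfolding rank_def using iterated_powerset(2) a_in_M a_separated by blast

lemma rank_0: "rank 0 = a"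
  by (simp add: rank_def)

lemma A_Suc: "A (Suc n) = {c \<in> M. elts c \<subseteq> A n}"
  unfolding rank_def using elts_iterated_powerset a_in_M a_separated by blast

lemma in_A_SucI: "c \<in> M \<Longrightarrow> (\<And>x. E x c \<Longrightarrow> x \<in> A n) \<Longrightarrow> c \<in> A (Suc n)"
  unfolding A_Suc by (auto simp: subset_iff)

lemma in_A_SucD: "c \<in> A (Suc n) \<Longrightarrow> E x c \<Longrightarrow> x \<in> A n"
  unfolding A_Suc by (auto simp: subset_iff)

lemma in_A_M: "x \<in> A n \<Longrightarrow> x \<in> M"
  using elts_subset by blast

lemma A_extensional:
  assumes "x \<in> A (Suc n)" "y \<in> A (Suc n)" "\<And>z. z \<in> A n \<Longrightarrow> E z x \<longleftrightarrow> E z y"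
  shows "x = y"
  by (rule extensional) (use assms in_A_M in_A_SucD in blast)+

lemma A_eq: "x \<in> A n \<Longrightarrow> y \<in> A n \<Longrightarrow> d x y < \<epsilon> \<Longrightarrow> x = y"
  using rank_separated unfolding separated_def by blast

text \<open>Formulas have countably many variables, so countably many parameters can be named at once. Allowing
all of them, instead of finitely many, means that an assignment for arithmetical formulas can be
treated as parameters wholesale.\<close>
definition params :: "'a set \<Rightarrow> bool" where
  "params K \<longleftrightarrow> countable K \<and> K \<subseteq> M \<and> range rank \<subseteq> K"

definition typed :: "nat list \<Rightarrow> 'a list \<Rightarrow> bool" where
  "typed = list_all2 (\<lambda>m x. x \<in> A m)"

text \<open>Contexts grow at the head of the list, whereas variable \<open>2 * n\<close> names the \<open>n\<close>-th entry from the end: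
extending a context leaves the names in use untouched. The odd variables name the parameters. Even
variables beyond the context are unconstrained, which makes them fresh for every formula considered.\<close>
definition assigns :: "'a set \<Rightarrow> 'a list \<Rightarrow> (nat \<Rightarrow> 'a) \<Rightarrow> bool" where
  "assigns K xs e \<longleftrightarrow> range e \<subseteq> M \<and> (\<forall>n<length xs. e (2 * n) = rev xs ! n) \<and>
     (\<forall>n. e (2 * n + 1) = from_nat_into K n)"

text \<open>A term of rank \<open>m\<close> in context \<open>\<rho>\<close>: in practice an entry of the context, written with \<open>hd\<close> and \<open>tl\<close>, or a
parameter. This form lets the closure rules below be applied directly to predicates written as
ordinary lambda terms.\<close>
definition ranked_term :: "'a set \<Rightarrow> nat list \<Rightarrow> nat \<Rightarrow> ('a list \<Rightarrow> 'a) \<Rightarrow> bool" where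
  "ranked_term K \<rho> m v \<longleftrightarrow> params K \<longrightarrow> (\<forall>xs. typed \<rho> xs \<longrightarrow> v xs \<in> A m) \<and>
     (\<exists>w. \<forall>xs e. typed \<rho> xs \<longrightarrow> assigns K xs e \<longrightarrow> e w = v xs)"

text \<open>Excision needs a gap between the values where \<open>P\<close> holds and those where it fails, and a gap survives
negation, as vanishing of a formula alone would not. The condition on \<open>K\<close> is a premise inside the
definition, so that the closure rules have no side conditions.\<close>
definition definable :: "'a set \<Rightarrow> nat list \<Rightarrow> ('a list \<Rightarrow> bool) \<Rightarrow> bool" where
  "definable K \<rho> P \<longleftrightarrow> params K \<longrightarrow> (\<exists>p. \<forall>xs e. typed \<rho> xs \<longrightarrow> assigns K xs e \<longrightarrow>
     (P xs \<longrightarrow> fval M d E p e \<le> 0) \<and> (\<not> P xs \<longrightarrow> 1 \<le> fval M d E p e))"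

lemma params_range: "params K \<Longrightarrow> c \<in> K \<Longrightarrow> \<exists>k. from_nat_into K k = c"
  unfolding params_def by (meson from_nat_into_surj)

lemma typed_Nil [simp]: "typed [] []"
  by (simp add: typed_def)

lemma typed_Cons [simp]: "typed (m # \<rho>) (x # xs) \<longleftrightarrow> x \<in> A m \<and> typed \<rho> xs"
  by (simp add: typed_def)

lemma typed_ConsE:
  assumes "typed (m # \<rho>) ys" obtains x xs where "ys = x # xs" "x \<in> A m" "typed \<rho> xs"
  using assms by (cases ys) (auto simp: typed_def)

lemma typed_length: "typed \<rho> xs \<Longrightarrow> length xs = length \<rho>"
  by (simp add: typed_def list_all2_lengthD)

lemma assigns_Cons:
  assumes "assigns K xs e" "x \<in> M" shows "assigns K (x # xs) (e(2 * length xs := x))"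
  using assms unfolding assigns_def
  by (auto simp: nth_append less_Suc_eq) presburger+

lemma assigns_tl: "assigns K (x # xs) e \<Longrightarrow> assigns K xs e"
  unfolding assigns_def by (auto simp: nth_append dest: spec)

lemma ranked_term_in: "params K \<Longrightarrow> ranked_term K \<rho> m v \<Longrightarrow> typed \<rho> xs \<Longrightarrow> v xs \<in> A m"
  by (simp add: ranked_term_def)

lemma ranked_term_const: "c \<in> K \<Longrightarrow> c \<in> A m \<Longrightarrow> ranked_term K \<rho> m (\<lambda>xs. c)"
  unfolding ranked_term_def assigns_def using params_range[of K c] by (metis)

lemma ranked_term_hd: "ranked_term K (m # \<rho>) m hd"
  unfolding ranked_term_def
proof (intro impI conjI allI)
  fix xs assume "typed (m # \<rho>) xs" then show "hd xs \<in> A m" by (elim typed_ConsE) simp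
next
  show "\<exists>w. \<forall>xs e. typed (m # \<rho>) xs \<longrightarrow> assigns K xs e \<longrightarrow> e w = hd xs"
  proof (intro exI[of _ "2 * length \<rho>"] allI impI)
    fix xs e assume "typed (m # \<rho>) xs" "assigns K xs e"
    then show "e (2 * length \<rho>) = hd xs"
      by (elim typed_ConsE) (auto simp: assigns_def nth_append typed_length)
  qed
qed

lemma ranked_term_tl: "ranked_term K \<rho> m v \<Longrightarrow> ranked_term K (n # \<rho>) m (\<lambda>xs. v (tl xs))"
  unfolding ranked_term_def by (metis assigns_tl list.sel(3) typed_ConsE)

lemma definable_cong:
  assumes "definable K \<rho> Q" "\<And>xs. params K \<Longrightarrow> typed \<rho> xs \<Longrightarrow> P xs \<longleftrightarrow> Q xs"
  shows "definable K \<rho> P"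
  using assms unfolding definable_def by metis

text \<open>Distinct points of one rank have distance at least \<open>\<epsilon>\<close>, so rescaling the distance gives the gap.\<close>
lemma definable_eq:
  assumes "ranked_term K \<rho> m u" "ranked_term K \<rho> m v"
  shows "definable K \<rho> (\<lambda>xs. u xs = v xs)"
  unfolding definable_def
proof
  assume K: "params K"
  obtain i j where i: "\<And>xs e. typed \<rho> xs \<Longrightarrow> assigns K xs e \<Longrightarrow> e i = u xs"
    and j: "\<And>xs e. typed \<rho> xs \<Longrightarrow> assigns K xs e \<Longrightarrow> e j = v xs"
    using assms K unfolding ranked_term_def by blast
  show "\<exists>p. \<forall>xs e. typed \<rho> xs \<longrightarrow> assigns K xs e \<longrightarrow>
     (u xs = v xs \<longrightarrow> fval M d E p e \<le> 0) \<and> (u xs \<noteq> v xs \<longrightarrow> 1 \<le> fval M d E p e)"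
  proof (intro exI[of _ "Scale (1 / \<epsilon>) (Dist i j)"] allI impI)
    fix xs e assume xs: "typed \<rho> xs" "assigns K xs e"
    have uv: "u xs \<in> A m" "v xs \<in> A m" using assms[THEN ranked_term_in[OF K]] xs by auto
    then have "d (u xs) (v xs) \<ge> \<epsilon>" if "u xs \<noteq> v xs" using A_eq that by force
    then show "(u xs = v xs \<longrightarrow> fval M d E (Scale (1 / \<epsilon>) (Dist i j)) e \<le> 0) \<and>
        (u xs \<noteq> v xs \<longrightarrow> 1 \<le> fval M d E (Scale (1 / \<epsilon>) (Dist i j)) e)"
      using i[OF xs] j[OF xs] eps uv[THEN in_A_M] by simp
  qed
qed

text \<open>The distance from \<open>x\<close> to the elements of \<open>y\<close> is 0 or at least \<open>\<epsilon>\<close>; for empty \<open>y\<close> the semantics gives the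
value 1, which is also at least \<open>\<epsilon>\<close>.\<close>
lemma definable_mem:
  assumes "ranked_term K \<rho> m u" "ranked_term K \<rho> (Suc m) v"
  shows "definable K \<rho> (\<lambda>xs. E (u xs) (v xs))"
  unfolding definable_def
proof
  assume K: "params K"
  obtain i j where i: "\<And>xs e. typed \<rho> xs \<Longrightarrow> assigns K xs e \<Longrightarrow> e i = u xs"
    and j: "\<And>xs e. typed \<rho> xs \<Longrightarrow> assigns K xs e \<Longrightarrow> e j = v xs"
    using assms K unfolding ranked_term_def by blast
  let ?q = "InfB (Suc i) j (Dist i (Suc i))"
  show "\<exists>p. \<forall>xs e. typed \<rho> xs \<longrightarrow> assigns K xs e \<longrightarrow>
     (E (u xs) (v xs) \<longrightarrow> fval M d E p e \<le> 0) \<and> (\<not> E (u xs) (v xs) \<longrightarrow> 1 \<le> fval M d E p e)"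
  proof (intro exI[of _ "Scale (1 / \<epsilon>) ?q"] allI impI conjI)
    fix xs e assume xs: "typed \<rho> xs" "assigns K xs e"
    have uv: "u xs \<in> A m" "v xs \<in> A (Suc m)" using assms[THEN ranked_term_in[OF K]] xs by auto
    have eM: "range e \<subseteq> M" using xs by (simp add: assigns_def)
    {
      assume E: "E (u xs) (v xs)"
      have "fval M d E ?q e \<le> fval M d E (Dist i (Suc i)) (e(Suc i := u xs))"
        by (rule InfB_le[OF eM]) (use E j[OF xs] in simp)
      also have "\<dots> = 0" using i[OF xs] uv[THEN in_A_M] by simp
      finally show "fval M d E (Scale (1 / \<epsilon>) ?q) e \<le> 0"
        using eps by (simp add: divide_nonpos_pos del: fval.simps(10))
    next
      assume nE: "\<not> E (u xs) (v xs)"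
      have "\<epsilon> \<le> fval M d E ?q e"
      proof (rule ccontr)
        assume "\<not> ?thesis"
        then have "fval M d E ?q e < \<epsilon>" by simp
        from InfB_less[OF this eps(2)] obtain z where z: "E z (v xs)" "d (u xs) z < \<epsilon>"
          using i[OF xs] j[OF xs] by auto
        then have "u xs = z" using A_eq uv in_A_SucD by blast
        then show False using z nE by simp
      qed
      then show "1 \<le> fval M d E (Scale (1 / \<epsilon>) ?q) e"
        using eps by (simp del: fval.simps(10))
    }
  qed
qed

lemma definable_not: "definable K \<rho> P \<Longrightarrow> definable K \<rho> (\<lambda>xs. \<not> P xs)"
  unfolding definable_def
proof (intro impI)
  assume "params K \<longrightarrow> (\<exists>p. \<forall>xs e. typed \<rho> xs \<longrightarrow> assigns K xs e \<longrightarrow>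
     (P xs \<longrightarrow> fval M d E p e \<le> 0) \<and> (\<not> P xs \<longrightarrow> 1 \<le> fval M d E p e))" and "params K"
  then obtain p where p: "\<forall>xs e. typed \<rho> xs \<longrightarrow> assigns K xs e \<longrightarrow>
     (P xs \<longrightarrow> fval M d E p e \<le> 0) \<and> (\<not> P xs \<longrightarrow> 1 \<le> fval M d E p e)" by blast
  show "\<exists>p. \<forall>xs e. typed \<rho> xs \<longrightarrow> assigns K xs e \<longrightarrow>
     (\<not> P xs \<longrightarrow> fval M d E p e \<le> 0) \<and> (\<not> \<not> P xs \<longrightarrow> 1 \<le> fval M d E p e)"
    by (rule exI[of _ "Plus Unit (Scale (-1) p)"]) (use p in simp)
qed

lemma definable_conj:
  assumes "definable K \<rho> P" "definable K \<rho> Q" shows "definable K \<rho> (\<lambda>xs. P xs \<and> Q xs)"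
  unfolding definable_def
proof (intro impI)
  assume "params K"
  then obtain p q where pq: "\<forall>xs e. typed \<rho> xs \<longrightarrow> assigns K xs e \<longrightarrow>
     (P xs \<longrightarrow> fval M d E p e \<le> 0) \<and> (\<not> P xs \<longrightarrow> 1 \<le> fval M d E p e)"
     "\<forall>xs e. typed \<rho> xs \<longrightarrow> assigns K xs e \<longrightarrow>
     (Q xs \<longrightarrow> fval M d E q e \<le> 0) \<and> (\<not> Q xs \<longrightarrow> 1 \<le> fval M d E q e)"
    using assms unfolding definable_def by blast
  show "\<exists>p. \<forall>xs e. typed \<rho> xs \<longrightarrow> assigns K xs e \<longrightarrow>
     ((P xs \<and> Q xs) \<longrightarrow> fval M d E p e \<le> 0) \<and> (\<not> (P xs \<and> Q xs) \<longrightarrow> 1 \<le> fval M d E p e)"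
    by (rule exI[of _ "MaxF p q"]) (use pq in \<open>auto simp: le_max_iff_disj\<close>)
qed

lemma definable_disj: "definable K \<rho> P \<Longrightarrow> definable K \<rho> Q \<Longrightarrow> definable K \<rho> (\<lambda>xs. P xs \<or> Q xs)"
  by (rule definable_cong[OF definable_not[OF definable_conj[OF definable_not definable_not]]]) auto

lemma definable_imp: "definable K \<rho> P \<Longrightarrow> definable K \<rho> Q \<Longrightarrow> definable K \<rho> (\<lambda>xs. P xs \<longrightarrow> Q xs)"
  by (rule definable_cong[OF definable_not[OF definable_conj[OF _ definable_not]]]) auto

lemma definable_iff: "definable K \<rho> P \<Longrightarrow> definable K \<rho> Q \<Longrightarrow> definable K \<rho> (\<lambda>xs. P xs \<longleftrightarrow> Q xs)"
  by (rule definable_cong[OF definable_conj[OF definable_imp definable_imp], of K \<rho> P Q Q P]) auto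

text \<open>Quantification over a rank is a bounded quantifier, because the rank is a parameter.\<close>
lemma definable_all:
  assumes "definable K (m # \<rho>) (\<lambda>xs. P (hd xs) (tl xs))"
  shows "definable K \<rho> (\<lambda>xs. \<forall>x\<in>A m. P x xs)"
  unfolding definable_def
proof
  assume K: "params K"
  obtain p where p: "\<And>xs e. typed (m # \<rho>) xs \<Longrightarrow> assigns K xs e \<Longrightarrow> P (hd xs) (tl xs) \<Longrightarrow> fval M d E p e \<le> 0"
     "\<And>xs e. typed (m # \<rho>) xs \<Longrightarrow> assigns K xs e \<Longrightarrow> \<not> P (hd xs) (tl xs) \<Longrightarrow> 1 \<le> fval M d E p e"
    using assms K unfolding definable_def by blast
  obtain k where k: "from_nat_into K k = rank m"
    using params_range[OF K] K unfolding params_def by blast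
  let ?q = "SupB (2 * length \<rho>) (2 * k + 1) p"
  show "\<exists>p. \<forall>xs e. typed \<rho> xs \<longrightarrow> assigns K xs e \<longrightarrow>
     ((\<forall>x\<in>A m. P x xs) \<longrightarrow> fval M d E p e \<le> 0) \<and> (\<not> (\<forall>x\<in>A m. P x xs) \<longrightarrow> 1 \<le> fval M d E p e)"
  proof (intro exI[of _ ?q] allI impI conjI)
    fix xs e assume xs: "typed \<rho> xs" and e: "assigns K xs e"
    have eM: "range e \<subseteq> M" and ek: "e (2 * k + 1) = rank m" using e k by (auto simp: assigns_def)
    have assigns_x: "assigns K (x # xs) (e(2 * length \<rho> := x))" if "x \<in> A m" for x
      using assigns_Cons[OF e in_A_M[OF that]] typed_length[OF xs] by simp
    {
      assume all: "\<forall>x\<in>A m. P x xs"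
      show "fval M d E ?q e \<le> 0"
      proof (rule SupB_le[OF eM])
        fix x assume "E x (e (2 * k + 1))"
        then have "x \<in> A m" using ek by simp
        then show "fval M d E p (e(2 * length \<rho> := x)) \<le> 0"
          using p(1)[of "x # xs"] all assigns_x xs by simp
      qed simp
    next
      assume "\<not> (\<forall>x\<in>A m. P x xs)"
      then obtain x where x: "x \<in> A m" "\<not> P x xs" by blast
      have "1 \<le> fval M d E p (e(2 * length \<rho> := x))"
        using p(2)[of "x # xs"] x assigns_x xs by simp
      also have "\<dots> \<le> fval M d E ?q e"
        by (rule SupB_ge[OF eM]) (use x ek in simp)
      finally show "1 \<le> fval M d E ?q e" .
    }
  qed
qed

lemma definable_ex:
  assumes "definable K (m # \<rho>) (\<lambda>xs. P (hd xs) (tl xs))"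
  shows "definable K \<rho> (\<lambda>xs. \<exists>x\<in>A m. P x xs)"
  by (rule definable_cong[OF definable_not[OF definable_all[OF definable_not[OF assms]]]]) auto

text \<open>Variable 2 lies outside the one-element context, so it is available as the fresh variable of
separation.\<close>
lemma comprehension_A:
  assumes K: "params K" and P: "definable K [m] (\<lambda>xs. P (hd xs))"
  shows "\<exists>b\<in>A (Suc m). \<forall>x. E x b \<longleftrightarrow> x \<in> A m \<and> P x"
proof -
  obtain p where p: "\<And>xs e. typed [m] xs \<Longrightarrow> assigns K xs e \<Longrightarrow> P (hd xs) \<Longrightarrow> fval M d E p e \<le> 0"
     "\<And>xs e. typed [m] xs \<Longrightarrow> assigns K xs e \<Longrightarrow> \<not> P (hd xs) \<Longrightarrow> 1 \<le> fval M d E p e"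
    using P K unfolding definable_def by blast
  obtain k where k: "from_nat_into K k = rank m"
    using params_range[OF K] K unfolding params_def by blast
  define e where "e n = (if even n then a else from_nat_into K (n div 2))" for n
  have "K \<noteq> {}" "K \<subseteq> M" using K by (auto simp: params_def)
  then have eM: "range e \<subseteq> M" using from_nat_into[of K] a_in_M by (auto simp: e_def)
  have assigns: "assigns K [y] (e(2 := c, 0 := y))" if "c \<in> M" "E y (rank m)" for c y
    unfolding assigns_def
  proof (intro conjI allI impI)
    show "range (e(2 := c, 0 := y)) \<subseteq> M" using eM that E_in_M by auto
    show "(e(2 := c, 0 := y)) (2 * n + 1) = from_nat_into K n" for n
      by (simp add: e_def)
  qed simp
  have "\<exists>b\<in>M. elts b = {y \<in> A m. P y}"
  proof (rule separation[OF rank_separated eps(1) eM])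
    show "e (2 * k + 1) = rank m" using k by (simp add: e_def)
    show "2 * k + 1 \<noteq> (2::nat)" by presburger
    show "(0::nat) \<noteq> 2" by simp
    show "fval M d E p (e(2 := c, 0 := y)) \<le> 0" if "c \<in> M" "E y (rank m)" "P y" for c y
      using p(1)[of "[y]"] assigns that by simp
    show "1 \<le> fval M d E p (e(2 := c, 0 := y))" if "c \<in> M" "E y (rank m)" "\<not> P y" for c y
      using p(2)[of "[y]"] assigns that by simp
  qed
  then obtain b where b: "b \<in> M" "elts b = {y \<in> A m. P y}" by blast
  then have "\<forall>x. E x b \<longleftrightarrow> x \<in> A m \<and> P x" using in_elts_iff by blast
  moreover from this b(1) have "b \<in> A (Suc m)" by (intro in_A_SucI) auto
  ultimately show ?thesis by blast
qed

lemma params_finite: "finite F \<Longrightarrow> F \<subseteq> M \<Longrightarrow> params (F \<union> range rank)"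
  using rank_in_M by (auto simp: params_def countable_finite)

lemmas definable_intros = definable_not definable_conj definable_disj definable_imp definable_iff definable_all definable_ex definable_eq definable_mem
  ranked_term_const ranked_term_hd ranked_term_tl

section \<open>Ordered pairs and internal bijections\<close>

lemma definable_False: "definable K \<rho> (\<lambda>xs. False)"
  unfolding definable_def by (intro impI exI[of _ Unit]) simp

text \<open>Apart from power sets, the definite descriptions used for arithmetic describe definable subsets of a
rank; this shows that they denote.\<close>
lemma the_set_A:
  assumes "finite F" "F \<subseteq> M" and P: "definable (F \<union> range rank) [m] (\<lambda>xs. P (hd xs))"
    and Q: "\<And>x. x \<in> M \<Longrightarrow> Q x \<longleftrightarrow> x \<in> A m \<and> P x"
  shows "the_set Q \<in> A (Suc m)" "E x (the_set Q) \<longleftrightarrow> x \<in> A m \<and> P x"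
proof -
  obtain b where b: "b \<in> A (Suc m)" "\<forall>x. E x b \<longleftrightarrow> x \<in> A m \<and> P x"
    using comprehension_A[OF params_finite[OF assms(1,2)] P] by blast
  have "the_set Q = b" by (rule the_set_eq) (use b Q in_A_M in auto)
  then show "the_set Q \<in> A (Suc m)" "E x (the_set Q) \<longleftrightarrow> x \<in> A m \<and> P x"
    using b by auto
qed

lemma empty_in_A: "empty \<in> A (Suc m)" and not_E_empty [simp]: "\<not> E x empty"
  using the_set_A[of "{}" m "\<lambda>x. False" "\<lambda>x. False"] definable_False unfolding empty_def by auto

lemma upair:
  assumes "x \<in> A m" "y \<in> A m"
  shows "upair x y \<in> A (Suc m)" "E z (upair x y) \<longleftrightarrow> z = x \<or> z = y"
proof -
  have "definable ({x, y} \<union> range rank) [m] (\<lambda>xs. hd xs = x \<or> hd xs = y)"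
    by (rule definable_intros assms | simp)+
  from the_set_A[OF _ _ this[THEN definable_cong], of "\<lambda>z. z = x \<or> z = y" "\<lambda>z. z = x \<or> z = y"]
  show "upair x y \<in> A (Suc m)" "E z (upair x y) \<longleftrightarrow> z = x \<or> z = y"
    using assms in_A_M unfolding upair_def by auto
qed

lemma single:
  assumes "x \<in> A m"
  shows "single x \<in> A (Suc m)" "E z (single x) \<longleftrightarrow> z = x"
  unfolding single_def using upair[OF assms assms] by auto

lemma opair_in_A:
  assumes "x \<in> A 0" "y \<in> A 0" shows "opair x y \<in> A r3"
  unfolding opair_def using assms by (intro upair single empty_in_A)

lemma opair_inject:
  assumes "x \<in> A 0" "y \<in> A 0" "x' \<in> A 0" "y' \<in> A 0"
  shows "opair x y = opair x' y' \<longleftrightarrow> x = x' \<and> y = y'"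
proof
  assume eq: "opair x y = opair x' y'"
  note s = single(2)[OF assms(1)] single(2)[OF assms(2)] single(2)[OF assms(3)] single(2)[OF assms(4)]
  note ss = single(2)[OF single(1)[OF assms(2)]] single(2)[OF single(1)[OF assms(4)]]
  note u = upair(2)[OF single(1)[OF assms(1)] empty_in_A] upair(2)[OF single(1)[OF assms(3)] empty_in_A]
  have "E q (opair x y) \<longleftrightarrow> q = upair (single x) empty \<or> q = single (single y)"
    "E q (opair x' y') \<longleftrightarrow> q = upair (single x') empty \<or> q = single (single y')" for q
    unfolding opair_def by (rule upair(2) upair(1) single(1) empty_in_A assms)+
  then have *: "q = upair (single x) empty \<or> q = single (single y) \<longleftrightarrow>
      q = upair (single x') empty \<or> q = single (single y')" for q
    using eq by simp
  have ne: "single y \<noteq> empty" "single y' \<noteq> empty" "single x \<noteq> empty"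
    using s not_E_empty by metis+
  have "upair (single x) empty \<noteq> single (single y')" "upair (single x') empty \<noteq> single (single y)"
    using ne u ss by metis+
  then have "upair (single x) empty = upair (single x') empty" "single (single y) = single (single y')"
    using * by metis+
  then have "single x = single x'" "single y = single y'"
    using ne u ss by metis+
  then show "x = x' \<and> y = y'" using s by metis
qed simp

lemma definable_upair:
  assumes "ranked_term K \<rho> (Suc m) u" "ranked_term K \<rho> m x" "ranked_term K \<rho> m y"
  shows "definable K \<rho> (\<lambda>xs. u xs = upair (x xs) (y xs))"
proof (rule definable_cong)
  show "definable K \<rho> (\<lambda>xs. \<forall>z\<in>A m. E z (u xs) \<longleftrightarrow> z = x xs \<or> z = y xs)"
    by (rule definable_intros assms)+
  fix xs assume *: "params K" "typed \<rho> xs"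
  note t = assms[THEN ranked_term_in[OF *(1)], OF *(2)]
  show "u xs = upair (x xs) (y xs) \<longleftrightarrow> (\<forall>z\<in>A m. E z (u xs) \<longleftrightarrow> z = x xs \<or> z = y xs)"
    using A_extensional[OF t(1) upair(1)[OF t(2,3)]] upair(2)[OF t(2,3)] by metis
qed

lemma definable_empty:
  assumes "ranked_term K \<rho> (Suc m) u"
  shows "definable K \<rho> (\<lambda>xs. u xs = empty)"
proof (rule definable_cong)
  show "definable K \<rho> (\<lambda>xs. \<forall>z\<in>A m. \<not> E z (u xs))"
    by (rule definable_intros assms)+
  fix xs assume *: "params K" "typed \<rho> xs"
  show "u xs = empty \<longleftrightarrow> (\<forall>z\<in>A m. \<not> E z (u xs))"
    using A_extensional[OF ranked_term_in[OF *(1) assms *(2)] empty_in_A] not_E_empty by metis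
qed

lemma definable_opair:
  assumes "ranked_term K \<rho> r3 p" "ranked_term K \<rho> 0 x" "ranked_term K \<rho> 0 y"
  shows "definable K \<rho> (\<lambda>xs. p xs = opair (x xs) (y xs))"
proof (rule definable_cong)
  show "definable K \<rho> (\<lambda>xs. \<exists>s\<in>A r1. \<exists>t\<in>A r1. \<exists>o'\<in>A r1. \<exists>q\<in>A r2. \<exists>r\<in>A r2. s = upair (x xs) (x xs) \<and>
      t = upair (y xs) (y xs) \<and> o' = empty \<and> q = upair s o' \<and> r = upair t t \<and> p xs = upair q r)"
    by (rule definable_not definable_conj definable_ex definable_upair definable_empty ranked_term_hd ranked_term_tl assms)+
  fix xs assume *: "params K" "typed \<rho> xs"
  note t = assms[THEN ranked_term_in[OF *(1)], OF *(2)]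
  show "p xs = opair (x xs) (y xs) \<longleftrightarrow> (\<exists>s\<in>A r1. \<exists>t\<in>A r1. \<exists>o'\<in>A r1. \<exists>q\<in>A r2. \<exists>r\<in>A r2. s = upair (x xs) (x xs) \<and>
      t = upair (y xs) (y xs) \<and> o' = empty \<and> q = upair s o' \<and> r = upair t t \<and> p xs = upair q r)"
    unfolding opair_def single_def using t by (metis upair(1) empty_in_A)
qed

definition pair_in :: "'a \<Rightarrow> 'a \<Rightarrow> 'a \<Rightarrow> bool" where
  "pair_in g x y \<longleftrightarrow> x \<in> A 0 \<and> y \<in> A 0 \<and> E (opair x y) g"

lemma definable_pair_in:
  assumes "ranked_term K \<rho> r4 g" "ranked_term K \<rho> 0 x" "ranked_term K \<rho> 0 y"
  shows "definable K \<rho> (\<lambda>xs. pair_in (g xs) (x xs) (y xs))"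
proof (rule definable_cong)
  show "definable K \<rho> (\<lambda>xs. \<exists>p\<in>A r3. p = opair (x xs) (y xs) \<and> E p (g xs))"
    by (rule definable_opair definable_conj definable_ex definable_mem ranked_term_hd ranked_term_tl assms)+
  fix xs assume *: "params K" "typed \<rho> xs"
  note t = assms[THEN ranked_term_in[OF *(1)], OF *(2)]
  show "pair_in (g xs) (x xs) (y xs) \<longleftrightarrow> (\<exists>p\<in>A r3. p = opair (x xs) (y xs) \<and> E p (g xs))"
    unfolding pair_in_def using t opair_in_A by blast
qed

definition internal :: "('a \<Rightarrow> 'a \<Rightarrow> bool) \<Rightarrow> bool" where
  "internal R \<longleftrightarrow> (\<exists>g\<in>A r4. R = pair_in g)"

text \<open>The context of \<open>R\<close> has a third entry because the graph is separated from rank 3 by a formula about a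
pair and its two coordinates.\<close>
lemma internalI:
  assumes "finite F" "F \<subseteq> M"
    and R: "definable (F \<union> range rank) [0, 0, r3] (\<lambda>xs. R (hd (tl xs)) (hd xs))"
    and A: "\<And>x y. R x y \<Longrightarrow> x \<in> A 0 \<and> y \<in> A 0"
  shows "internal R"
proof -
  have "definable (F \<union> range rank) [r3] (\<lambda>xs. \<exists>x\<in>A 0. \<exists>y\<in>A 0. hd xs = opair x y \<and> R x y)"
    by (rule definable_ex definable_conj definable_opair ranked_term_tl ranked_term_hd R)+
  from comprehension_A[OF params_finite[OF assms(1,2)] this]
  obtain g where g: "g \<in> A r4"
    "\<And>p. E p g \<longleftrightarrow> p \<in> A r3 \<and> (\<exists>x\<in>A 0. \<exists>y\<in>A 0. p = opair x y \<and> R x y)" by blast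
  have "R x y \<longleftrightarrow> pair_in g x y" for x y
    unfolding pair_in_def g(2) using A opair_in_A opair_inject by metis
  then show ?thesis unfolding internal_def using g(1) by blast
qed

text \<open>Bijections are handled as relations: composing, inverting, extending and restricting them
then stays within first-order formulas, and definability is immediate.\<close>
definition bij_rel :: "'a \<Rightarrow> 'a \<Rightarrow> ('a \<Rightarrow> 'a \<Rightarrow> bool) \<Rightarrow> bool" where
  "bij_rel c f R \<longleftrightarrow> (\<forall>x y. R x y \<longrightarrow> E x c \<and> E y f) \<and> (\<forall>x. E x c \<longrightarrow> (\<exists>y. R x y)) \<and>
     (\<forall>y. E y f \<longrightarrow> (\<exists>x. R x y)) \<and> (\<forall>x y x' y'. R x y \<longrightarrow> R x' y' \<longrightarrow> (x = x' \<longleftrightarrow> y = y'))"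

lemma bij_relD:
  assumes "bij_rel c f R"
  shows "R x y \<Longrightarrow> E x c" "R x y \<Longrightarrow> E y f" "E x c \<Longrightarrow> \<exists>y. R x y" "E y f \<Longrightarrow> \<exists>x. R x y"
    "R x y \<Longrightarrow> R x' y \<Longrightarrow> x = x'" "R x y \<Longrightarrow> R x y' \<Longrightarrow> y = y'"
  using assms unfolding bij_rel_def by metis+

lemma bij_relI:
  assumes "\<And>x y. R x y \<Longrightarrow> E x c \<and> E y f" "\<And>x. E x c \<Longrightarrow> \<exists>y. R x y" "\<And>y. E y f \<Longrightarrow> \<exists>x. R x y"
    "\<And>x x' y. R x y \<Longrightarrow> R x' y \<Longrightarrow> x = x'" "\<And>x y y'. R x y \<Longrightarrow> R x y' \<Longrightarrow> y = y'"
  shows "bij_rel c f R"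
  using assms unfolding bij_rel_def by metis

lemma bij_rel_iff_bij_betw:
  "bij_rel c f R \<longleftrightarrow> (\<exists>h. bij_betw h (elts c) (elts f) \<and> R = (\<lambda>x y. E x c \<and> y = h x))"
proof
  assume R: "bij_rel c f R"
  note D = bij_relD[OF R]
  obtain h where h: "\<And>x. E x c \<Longrightarrow> R x (h x)" using D(3) by metis
  have Rh: "R x y \<longleftrightarrow> E x c \<and> y = h x" for x y
    using D(1,6) h by metis
  have "bij_betw h (elts c) (elts f)"
  proof (rule bij_betwI')
    show "h x = h x' \<longleftrightarrow> x = x'" if "x \<in> elts c" "x' \<in> elts c" for x x'
      using h D(5) that in_elts_iff by metis
    show "h x \<in> elts f" if "x \<in> elts c" for x
      using h D(2) that in_elts_iff by metis
    show "\<exists>x\<in>elts c. y = h x" if "y \<in> elts f" for y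
      using Rh D(4) that in_elts_iff by metis
  qed
  then show "\<exists>h. bij_betw h (elts c) (elts f) \<and> R = (\<lambda>x y. E x c \<and> y = h x)" using Rh by blast
next
  assume "\<exists>h. bij_betw h (elts c) (elts f) \<and> R = (\<lambda>x y. E x c \<and> y = h x)"
  then obtain h where h: "inj_on h (elts c)" "h ` elts c = elts f" and R: "R = (\<lambda>x y. E x c \<and> y = h x)"
    unfolding bij_betw_def by blast
  have 1: "E x c \<Longrightarrow> E (h x) f" for x using h(2) by (metis imageI in_elts_iff)
  have 2: "E y f \<Longrightarrow> \<exists>x. E x c \<and> y = h x" for y using h(2) by (metis imageE in_elts_iff)
  have 3: "E x c \<Longrightarrow> E x' c \<Longrightarrow> h x = h x' \<Longrightarrow> x = x'" for x x'
    using h(1) by (simp add: inj_on_def)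
  show "bij_rel c f R" unfolding R by (rule bij_relI) (use 1 2 3 in metis)+
qed

lemma E_A0: "c \<in> A r1 \<Longrightarrow> E x c \<Longrightarrow> x \<in> A 0"
  using in_A_SucD by blast

lemma A0_iff: "x \<in> A 0 \<longleftrightarrow> E x a"
  by (simp add: rank_0)

lemma product_a: "product a a \<in> A r4"
  "E p (product a a) \<longleftrightarrow> (\<exists>x\<in>A 0. \<exists>y\<in>A 0. p = opair x y)"
proof -
  define P where "P p \<longleftrightarrow> (\<exists>x\<in>A 0. \<exists>y\<in>A 0. p = opair x y)" for p
  have D: "definable ({} \<union> range rank) [r3] (\<lambda>xs. P (hd xs))"
    unfolding P_def by (rule definable_ex definable_opair ranked_term_tl ranked_term_hd)+
  have PA: "P p \<Longrightarrow> p \<in> A r3" for p unfolding P_def using opair_in_A by metis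
  have *: "(\<exists>x\<in>M. \<exists>y\<in>M. E x a \<and> E y a \<and> p = opair x y) \<longleftrightarrow> p \<in> A r3 \<and> P p" for p
    using PA unfolding P_def by (metis A0_iff in_A_M)
  note the_set_A[where P = P, OF finite.emptyI empty_subsetI D *, folded product_def]
  then show "product a a \<in> A r4" "E p (product a a) \<longleftrightarrow> (\<exists>x\<in>A 0. \<exists>y\<in>A 0. p = opair x y)"
    using PA[of p] unfolding P_def[symmetric] by blast+
qed

text \<open>The function in the definition of equinumerosity is external, but its graph is a set. Conversely a
set coding the relation may contain elements that are not pairs from \<open>a\<close>, so the graph has to be
separated from it.\<close>
lemma equinum_iff:
  assumes "c \<in> A r1" "f \<in> A r1"
  shows "equinum a c f \<longleftrightarrow> (\<exists>R. internal R \<and> bij_rel c f R)"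
proof
  assume "equinum a c f"
  then obtain g h where g: "g \<in> M" "sub g (product a a)" and h: "bij_betw h (elts c) (elts f)"
    and gh: "elts g = (\<lambda>x. opair x (h x)) ` elts c" unfolding equinum_def by blast
  have hc: "E x c \<Longrightarrow> h x \<in> A 0" for x
    using h E_A0[OF assms(2)] by (metis bij_betwE in_elts_iff)
  have "g \<in> A r4"
  proof (rule in_A_SucI[OF g(1)])
    fix p assume p: "E p g"
    then have "p \<in> M" using E_in_M by blast
    then show "p \<in> A r3" using p g(2) in_A_SucD[OF product_a(1)] unfolding sub_def by metis
  qed
  moreover have "pair_in g = (\<lambda>x y. E x c \<and> y = h x)"
  proof (intro ext)
    fix x y
    have "pair_in g x y \<longleftrightarrow> x \<in> A 0 \<and> y \<in> A 0 \<and> (\<exists>x'. E x' c \<and> opair x y = opair x' (h x'))"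
      unfolding pair_in_def in_elts_iff[of _ g, symmetric] gh by auto
    also have "\<dots> \<longleftrightarrow> E x c \<and> y = h x"
      using opair_inject hc E_A0[OF assms(1)] by metis
    finally show "pair_in g x y = (E x c \<and> y = h x)" .
  qed
  ultimately have "internal (\<lambda>x y. E x c \<and> y = h x)"
    unfolding internal_def by (intro bexI[of _ g]) (simp_all only:)
  moreover have "bij_rel c f (\<lambda>x y. E x c \<and> y = h x)"
    unfolding bij_rel_iff_bij_betw using h by (intro exI[of _ h]) simp
  ultimately show "\<exists>R. internal R \<and> bij_rel c f R" by blast
next
  assume "\<exists>R. internal R \<and> bij_rel c f R"
  then obtain R g h where R: "g \<in> A r4" "R = pair_in g" and h: "bij_betw h (elts c) (elts f)"
    and Rh: "R = (\<lambda>x y. E x c \<and> y = h x)"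
    unfolding bij_rel_iff_bij_betw internal_def by blast
  have "definable ({g} \<union> range rank) [r3] (\<lambda>xs. \<exists>x\<in>A 0. \<exists>y\<in>A 0. hd xs = opair x y \<and> pair_in g x y)"
    by (rule definable_ex definable_conj definable_opair definable_pair_in ranked_term_tl ranked_term_hd ranked_term_const R(1) | simp)+
  from comprehension_A[OF params_finite this] in_A_M[OF R(1)]
  obtain g' where g': "g' \<in> A r4" "\<And>p. E p g' \<longleftrightarrow> p \<in> A r3 \<and> (\<exists>x\<in>A 0. \<exists>y\<in>A 0. p = opair x y \<and> pair_in g x y)"
    by auto
  have pg: "pair_in g x y \<longleftrightarrow> E x c \<and> y = h x" for x y using R(2) Rh by metis
  have pA: "pair_in g x y \<Longrightarrow> x \<in> A 0 \<and> y \<in> A 0" for x y unfolding pair_in_def by simp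
  show "equinum a c f"
    unfolding equinum_def
  proof (intro bexI[of _ g'] conjI exI[of _ h] h)
    show "g' \<in> M" using g'(1) in_A_M by blast
    show "sub g' (product a a)" unfolding sub_def g'(2) product_a by blast
    have "E p g' \<longleftrightarrow> (\<exists>x. E x c \<and> p = opair x (h x))" for p
      unfolding g'(2) using pg pA opair_in_A by metis
    then show "elts g' = (\<lambda>x. opair x (h x)) ` elts c" unfolding set_eq_iff image_iff Bex_def in_elts_iff by blast
  qed
qed

lemma definable_equinum:
  assumes "ranked_term K \<rho> r1 c" "ranked_term K \<rho> r1 f"
  shows "definable K \<rho> (\<lambda>xs. equinum a (c xs) (f xs))"
proof (rule definable_cong)
  show "definable K \<rho> (\<lambda>xs. \<exists>g\<in>A r4. (\<forall>x\<in>A 0. \<forall>y\<in>A 0. pair_in g x y \<longrightarrow> E x (c xs) \<and> E y (f xs)) \<and>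
     (\<forall>x\<in>A 0. E x (c xs) \<longrightarrow> (\<exists>y\<in>A 0. pair_in g x y)) \<and>
     (\<forall>y\<in>A 0. E y (f xs) \<longrightarrow> (\<exists>x\<in>A 0. pair_in g x y)) \<and>
     (\<forall>x\<in>A 0. \<forall>y\<in>A 0. \<forall>x'\<in>A 0. \<forall>y'\<in>A 0. pair_in g x y \<longrightarrow> pair_in g x' y' \<longrightarrow> (x = x' \<longleftrightarrow> y = y')))"
    by (rule definable_all definable_ex definable_conj definable_imp definable_iff definable_pair_in definable_mem definable_eq ranked_term_tl ranked_term_hd assms)+
  fix xs assume *: "params K" "typed \<rho> xs"
  note t = assms[THEN ranked_term_in[OF *(1)], OF *(2)]
  have eq: "equinum a (c xs) (f xs) \<longleftrightarrow> (\<exists>g\<in>A r4. bij_rel (c xs) (f xs) (pair_in g))"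
    unfolding equinum_iff[OF t] internal_def by metis
  have "bij_rel (c xs) (f xs) (pair_in g) \<longleftrightarrow> (\<forall>x\<in>A 0. \<forall>y\<in>A 0. pair_in g x y \<longrightarrow> E x (c xs) \<and> E y (f xs)) \<and>
     (\<forall>x\<in>A 0. E x (c xs) \<longrightarrow> (\<exists>y\<in>A 0. pair_in g x y)) \<and>
     (\<forall>y\<in>A 0. E y (f xs) \<longrightarrow> (\<exists>x\<in>A 0. pair_in g x y)) \<and>
     (\<forall>x\<in>A 0. \<forall>y\<in>A 0. \<forall>x'\<in>A 0. \<forall>y'\<in>A 0. pair_in g x y \<longrightarrow> pair_in g x' y' \<longrightarrow> (x = x' \<longleftrightarrow> y = y'))" for g
  proof -
    have "pair_in g x y \<Longrightarrow> x \<in> A 0 \<and> y \<in> A 0" for x y by (simp add: pair_in_def)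
    then show ?thesis unfolding bij_rel_def using E_A0[OF t(1)] E_A0[OF t(2)]
      by (intro arg_cong2[where f = "(\<and>)"]) metis+
  qed
  then show "equinum a (c xs) (f xs) \<longleftrightarrow> (\<exists>g\<in>A r4. (\<forall>x\<in>A 0. \<forall>y\<in>A 0. pair_in g x y \<longrightarrow> E x (c xs) \<and> E y (f xs)) \<and>
     (\<forall>x\<in>A 0. E x (c xs) \<longrightarrow> (\<exists>y\<in>A 0. pair_in g x y)) \<and>
     (\<forall>y\<in>A 0. E y (f xs) \<longrightarrow> (\<exists>x\<in>A 0. pair_in g x y)) \<and>
     (\<forall>x\<in>A 0. \<forall>y\<in>A 0. \<forall>x'\<in>A 0. \<forall>y'\<in>A 0. pair_in g x y \<longrightarrow> pair_in g x' y' \<longrightarrow> (x = x' \<longleftrightarrow> y = y')))"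
    unfolding eq by (simp only:)
qed

section \<open>Cardinals and successors\<close>

definition add_one :: "'a \<Rightarrow> 'a \<Rightarrow> bool" where
  "add_one f c \<longleftrightarrow> (\<exists>z\<in>A 0. \<not> E z f \<and> (\<forall>x. E x c \<longleftrightarrow> E x f \<or> x = z))"

lemma equinumI: "c \<in> A r1 \<Longrightarrow> f \<in> A r1 \<Longrightarrow> internal R \<Longrightarrow> bij_rel c f R \<Longrightarrow> equinum a c f"
  using equinum_iff by metis

lemma equinumE:
  assumes "equinum a c f" "c \<in> A r1" "f \<in> A r1"
  obtains g where "g \<in> A r4" "bij_rel c f (pair_in g)"
  using assms equinum_iff unfolding internal_def by metis

lemma pair_in_A: "pair_in g x y \<Longrightarrow> x \<in> A 0 \<and> y \<in> A 0"
  by (simp add: pair_in_def)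

lemma equinum_refl:
  assumes c: "c \<in> A r1" shows "equinum a c c"
proof (rule equinumI[OF c c])
  show "internal (\<lambda>x y. E x c \<and> x = y)"
  proof (rule internalI[of "{c}"])
    show "definable ({c} \<union> range rank) [0, 0, r3] (\<lambda>xs. E (hd (tl xs)) c \<and> hd (tl xs) = hd xs)"
      by (rule definable_conj definable_mem definable_eq ranked_term_tl ranked_term_hd ranked_term_const c | simp)+
  qed (use c in_A_M E_A0 in auto)
  show "bij_rel c c (\<lambda>x y. E x c \<and> x = y)"
    by (rule bij_relI) auto
qed

lemma equinum_sym:
  assumes "equinum a c f" and cf: "c \<in> A r1" "f \<in> A r1"
  shows "equinum a f c"
proof -
  obtain g where g: "g \<in> A r4" and b: "bij_rel c f (pair_in g)" using assms by (rule equinumE)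
  show ?thesis
  proof (rule equinumI[OF cf(2,1)])
    show "internal (\<lambda>x y. pair_in g y x)"
    proof (rule internalI[of "{g}"])
      show "definable ({g} \<union> range rank) [0, 0, r3] (\<lambda>xs. pair_in g (hd xs) (hd (tl xs)))"
        by (rule definable_pair_in ranked_term_tl ranked_term_hd ranked_term_const g | simp)+
    qed (use g in_A_M pair_in_A in auto)
    show "bij_rel f c (\<lambda>x y. pair_in g y x)"
      by (rule bij_relI) (use bij_relD[OF b] in metis)+
  qed
qed

lemma equinum_trans:
  assumes "equinum a c f" "equinum a f k" and cfk: "c \<in> A r1" "f \<in> A r1" "k \<in> A r1"
  shows "equinum a c k"
proof -
  obtain g where g: "g \<in> A r4" and b: "bij_rel c f (pair_in g)" using assms by (elim equinumE)
  obtain h where h: "h \<in> A r4" and b': "bij_rel f k (pair_in h)" using assms by (elim equinumE)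
  show ?thesis
  proof (rule equinumI[OF cfk(1,3)])
    show "internal (\<lambda>x y. \<exists>z\<in>A 0. pair_in g x z \<and> pair_in h z y)"
    proof (rule internalI[of "{g, h}"])
      show "definable ({g, h} \<union> range rank) [0, 0, r3]
          (\<lambda>xs. \<exists>z\<in>A 0. pair_in g (hd (tl xs)) z \<and> pair_in h z (hd xs))"
        by (rule definable_ex definable_conj definable_pair_in ranked_term_tl ranked_term_hd ranked_term_const g h | simp)+
    qed (use g h in_A_M pair_in_A in auto)
    show "bij_rel c k (\<lambda>x y. \<exists>z\<in>A 0. pair_in g x z \<and> pair_in h z y)"
      by (rule bij_relI) (use bij_relD[OF b] bij_relD[OF b'] pair_in_A in metis)+
  qed
qed

lemma equinum_add_one:
  assumes "equinum a c f" and A: "c \<in> A r1" "f \<in> A r1" "c' \<in> A r1" "f' \<in> A r1"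
    and "add_one c c'" "add_one f f'"
  shows "equinum a c' f'"
proof -
  obtain g where g: "g \<in> A r4" and b: "bij_rel c f (pair_in g)" using assms by (elim equinumE)
  obtain z where z: "z \<in> A 0" "\<not> E z c" "\<And>x. E x c' \<longleftrightarrow> E x c \<or> x = z"
    using assms(6) unfolding add_one_def by metis
  obtain w where w: "w \<in> A 0" "\<not> E w f" "\<And>x. E x f' \<longleftrightarrow> E x f \<or> x = w"
    using assms(7) unfolding add_one_def by metis
  show ?thesis
  proof (rule equinumI[OF A(3,4)])
    show "internal (\<lambda>x y. pair_in g x y \<or> x = z \<and> y = w)"
    proof (rule internalI[of "{g, z, w}"])
      show "definable ({g, z, w} \<union> range rank) [0, 0, r3]
          (\<lambda>xs. pair_in g (hd (tl xs)) (hd xs) \<or> hd (tl xs) = z \<and> hd xs = w)"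
        by (rule definable_disj definable_conj definable_eq definable_pair_in ranked_term_tl ranked_term_hd ranked_term_const g z w | simp)+
    qed (use g z(1) w(1) in_A_M pair_in_A in auto)
    show "bij_rel c' f' (\<lambda>x y. pair_in g x y \<or> x = z \<and> y = w)"
      by (rule bij_relI) (use bij_relD[OF b] z w in metis)+
  qed
qed

text \<open>Reroute around the removed points \<open>z\<close> and \<open>w\<close>: the element mapped to \<open>w\<close> is sent to the image of \<open>z\<close>.\<close>
lemma equinum_remove_one:
  assumes "equinum a c' f'" and A: "c \<in> A r1" "f \<in> A r1" "c' \<in> A r1" "f' \<in> A r1"
    and "add_one c c'" "add_one f f'"
  shows "equinum a c f"
proof -
  obtain g where g: "g \<in> A r4" and b: "bij_rel c' f' (pair_in g)" using assms by (elim equinumE)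
  obtain z where z: "z \<in> A 0" "\<not> E z c" "\<And>x. E x c' \<longleftrightarrow> E x c \<or> x = z"
    using assms(6) unfolding add_one_def by metis
  obtain w where w: "w \<in> A 0" "\<not> E w f" "\<And>x. E x f' \<longleftrightarrow> E x f \<or> x = w"
    using assms(7) unfolding add_one_def by metis
  note D = bij_relD[OF b]
  \<comment> \<open>When \<open>z\<close> itself is mapped to \<open>w\<close>, the second disjunct never applies to an element of \<open>c\<close>.\<close>
  let ?R = "\<lambda>x y. (E x c \<and> E y f) \<and> (pair_in g x y \<or> pair_in g x w \<and> pair_in g z y)"
  show ?thesis
  proof (rule equinumI[OF A(1,2)])
    show "internal ?R"
    proof (rule internalI[of "{g, z, w, c, f}"])
      show "definable ({g, z, w, c, f} \<union> range rank) [0, 0, r3]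
          (\<lambda>xs. (E (hd (tl xs)) c \<and> E (hd xs) f) \<and>
            (pair_in g (hd (tl xs)) (hd xs) \<or> pair_in g (hd (tl xs)) w \<and> pair_in g z (hd xs)))"
        by (rule definable_disj definable_conj definable_mem definable_pair_in ranked_term_tl ranked_term_hd ranked_term_const g z w A | simp)+
    qed (use g z(1) w(1) A in_A_M E_A0 in auto)
    show "bij_rel c f ?R"
    proof (rule bij_relI)
      show "\<exists>y. ?R x y" if x: "E x c" for x
      proof -
        obtain y y0 where "pair_in g x y" "pair_in g z y0" using D(3) z(3) x by metis
        then show ?thesis using D(2,5) z w that by metis
      qed
      show "\<exists>x. ?R x y" if y: "E y f" for y
      proof -
        obtain x x0 where "pair_in g x y" "pair_in g x0 w" using D(4) w(3) y by metis
        then show ?thesis using D(1,6) z w that by metis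
      qed
      show "x = x'" if "?R x y" "?R x' y" for x x' y
        using that D(5) z(2) by metis
      show "y = y'" if "?R x y" "?R x y'" for x y y'
        using that D(6) w(2) by metis
    qed simp
  qed
qed

text \<open>Restricting a bijection to \<open>c\<close> leaves out exactly the image of the additional point.\<close>
lemma equinum_split:
  assumes "equinum a c' f'" and A: "c \<in> A r1" "c' \<in> A r1" "f' \<in> A r1" and "add_one c c'"
  obtains f where "f \<in> A r1" "equinum a c f" "add_one f f'"
proof -
  obtain g where g: "g \<in> A r4" and b: "bij_rel c' f' (pair_in g)" using assms by (elim equinumE)
  obtain z where z: "z \<in> A 0" "\<not> E z c" "\<And>x. E x c' \<longleftrightarrow> E x c \<or> x = z"
    using assms(5) unfolding add_one_def by metis
  note D = bij_relD[OF b]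
  have "definable ({g, c} \<union> range rank) [0] (\<lambda>xs. \<exists>x\<in>A 0. E x c \<and> pair_in g x (hd xs))"
    by (rule definable_ex definable_conj definable_mem definable_pair_in ranked_term_tl ranked_term_hd ranked_term_const g A | simp)+
  from comprehension_A[OF params_finite this] obtain f where f: "f \<in> A r1"
    "\<And>y. E y f \<longleftrightarrow> y \<in> A 0 \<and> (\<exists>x\<in>A 0. E x c \<and> pair_in g x y)"
    using in_A_M g A by auto
  have Ef: "E y f \<longleftrightarrow> (\<exists>x. E x c \<and> pair_in g x y)" for y
    using f(2) pair_in_A by metis
  let ?R = "\<lambda>x y. E x c \<and> pair_in g x y"
  have "equinum a c f"
  proof (rule equinumI[OF A(1) f(1)])
    show "internal ?R"
    proof (rule internalI[of "{g, c}"])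
      show "definable ({g, c} \<union> range rank) [0, 0, r3] (\<lambda>xs. E (hd (tl xs)) c \<and> pair_in g (hd (tl xs)) (hd xs))"
        by (rule definable_conj definable_mem definable_pair_in ranked_term_tl ranked_term_hd ranked_term_const g A | simp)+
    qed (use g A in_A_M pair_in_A in auto)
    show "bij_rel c f ?R"
      by (rule bij_relI) (use D Ef z in metis)+
  qed
  moreover have "add_one f f'"
  proof -
    obtain w where w: "pair_in g z w" using D(3) z(3) by metis
    have "\<not> E w f" using Ef D(5) w z(2) by metis
    moreover have "E y f' \<longleftrightarrow> E y f \<or> y = w" for y
      using Ef D(2,4,6) D(1) z(3) w by metis
    ultimately show ?thesis unfolding add_one_def using pair_in_A[OF w] by blast
  qed
  ultimately show ?thesis using that f(1) by blast
qed

lemma definable_add_one: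
  assumes "ranked_term K \<rho> r1 f" "ranked_term K \<rho> r1 c"
  shows "definable K \<rho> (\<lambda>xs. add_one (f xs) (c xs))"
proof (rule definable_cong)
  show "definable K \<rho> (\<lambda>xs. \<exists>z\<in>A 0. \<not> E z (f xs) \<and> (\<forall>x\<in>A 0. E x (c xs) \<longleftrightarrow> E x (f xs) \<or> x = z))"
    by (rule definable_intros assms)+
  fix xs assume *: "params K" "typed \<rho> xs"
  note t = assms[THEN ranked_term_in[OF *(1)], OF *(2)]
  show "add_one (f xs) (c xs) \<longleftrightarrow> (\<exists>z\<in>A 0. \<not> E z (f xs) \<and> (\<forall>x\<in>A 0. E x (c xs) \<longleftrightarrow> E x (f xs) \<or> x = z))"
    unfolding add_one_def using E_A0[OF t(1)] E_A0[OF t(2)] by metis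
qed

lemma succ:
  assumes b: "b \<in> A r2"
  shows "succ a b \<in> A r2" "E c (succ a b) \<longleftrightarrow> c \<in> A r1 \<and> (\<exists>f. E f b \<and> add_one f c)"
proof -
  define P where "P c \<longleftrightarrow> (\<exists>f\<in>A r1. E f b \<and> add_one f c)" for c
  have D: "definable ({b} \<union> range rank) [r1] (\<lambda>xs. P (hd xs))"
    unfolding P_def by (rule definable_ex definable_conj definable_mem definable_add_one ranked_term_tl ranked_term_hd ranked_term_const b | simp)+
  have A1: "c \<in> A r1 \<longleftrightarrow> c \<in> M \<and> (\<forall>x. E x c \<longrightarrow> E x a)" for c
    unfolding A_Suc using A0_iff by (auto simp: subset_iff)
  have *: "(sub c a \<and> (\<exists>f\<in>M. E f b \<and> sub f c \<and> (\<exists>!g. g \<in> M \<and> E g c \<and> \<not> E g f))) \<longleftrightarrow> c \<in> A r1 \<and> P c"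
    if "c \<in> M" for c
  proof -
    have s: "sub c a \<longleftrightarrow> c \<in> A r1" unfolding sub_def A1 using that E_in_M by blast
    have "(sub f c \<and> (\<exists>!g. g \<in> M \<and> E g c \<and> \<not> E g f)) \<longleftrightarrow> add_one f c" if c: "c \<in> A r1" for f
    proof
      assume l: "sub f c \<and> (\<exists>!g. g \<in> M \<and> E g c \<and> \<not> E g f)"
      then obtain z where z: "E z c" "\<not> E z f" and u: "\<And>g. E g c \<Longrightarrow> \<not> E g f \<Longrightarrow> g = z"
        using E_in_M by metis
      have "E x f \<Longrightarrow> E x c" for x using l E_in_M unfolding sub_def by metis
      then have "\<forall>x. E x c \<longleftrightarrow> E x f \<or> x = z" using z u by metis
      then show "add_one f c" unfolding add_one_def using z E_A0[OF c] by metis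
    next
      assume "add_one f c"
      then obtain z where z: "\<not> E z f" "\<And>x. E x c \<longleftrightarrow> E x f \<or> x = z" unfolding add_one_def by metis
      have "sub f c" unfolding sub_def using z by metis
      moreover have "\<exists>!g. g \<in> M \<and> E g c \<and> \<not> E g f"
        by (rule ex1I[of _ z]) (use z E_in_M in metis)+
      ultimately show "sub f c \<and> (\<exists>!g. g \<in> M \<and> E g c \<and> \<not> E g f)" by blast
    qed
    moreover have "E f b \<Longrightarrow> f \<in> A r1 \<and> f \<in> M" for f using in_A_SucD[OF b] in_A_M by metis
    ultimately show ?thesis unfolding s P_def by metis
  qed
  have "b \<in> M" using b in_A_M by metis
  then have fin: "finite {b}" "{b} \<subseteq> M" by auto
  note the_set_A[where P = P, OF fin D *, folded succ_def]
  moreover have "P c \<longleftrightarrow> (\<exists>f. E f b \<and> add_one f c)"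
    unfolding P_def using in_A_SucD[OF b] by metis
  ultimately show "succ a b \<in> A r2" "E c (succ a b) \<longleftrightarrow> c \<in> A r1 \<and> (\<exists>f. E f b \<and> add_one f c)"
    by metis+
qed

lemma definable_succ:
  assumes "ranked_term K \<rho> r2 y" "ranked_term K \<rho> r2 x"
  shows "definable K \<rho> (\<lambda>xs. y xs = succ a (x xs))"
proof (rule definable_cong)
  show "definable K \<rho> (\<lambda>xs. \<forall>c\<in>A r1. E c (y xs) \<longleftrightarrow> (\<exists>f\<in>A r1. E f (x xs) \<and> add_one f c))"
    by (rule definable_add_one definable_intros assms)+
  fix xs assume *: "params K" "typed \<rho> xs"
  note t = assms[THEN ranked_term_in[OF *(1)], OF *(2)]
  have "c \<in> A r1 \<Longrightarrow> E c (succ a (x xs)) \<longleftrightarrow> (\<exists>f\<in>A r1. E f (x xs) \<and> add_one f c)" for c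
    using succ(2)[OF t(2)] in_A_SucD[OF t(2)] by metis
  then show "y xs = succ a (x xs) \<longleftrightarrow> (\<forall>c\<in>A r1. E c (y xs) \<longleftrightarrow> (\<exists>f\<in>A r1. E f (x xs) \<and> add_one f c))"
    using A_extensional[OF t(1) succ(1)[OF t(2)]] by metis
qed

lemma cardinal:
  assumes c: "c \<in> A r1"
  shows "cardinal a c \<in> A r2" "E f (cardinal a c) \<longleftrightarrow> f \<in> A r1 \<and> equinum a c f"
proof -
  have D: "definable ({c} \<union> range rank) [r1] (\<lambda>xs. equinum a c (hd xs))"
    by (rule definable_equinum ranked_term_tl ranked_term_hd ranked_term_const c | simp)+
  have *: "sub f a \<and> equinum a c f \<longleftrightarrow> f \<in> A r1 \<and> equinum a c f" if "f \<in> M" for f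
    unfolding sub_iff A_Suc rank_0 using that by simp
  have "c \<in> M" using c in_A_M by metis
  then have fin: "finite {c}" "{c} \<subseteq> M" by auto
  note the_set_A[where P = "equinum a c", OF fin D *, folded cardinal_def]
  then show "cardinal a c \<in> A r2" "E f (cardinal a c) \<longleftrightarrow> f \<in> A r1 \<and> equinum a c f" by blast+
qed

lemma cardinal_eq_iff:
  assumes "c \<in> A r1" "f \<in> A r1"
  shows "cardinal a c = cardinal a f \<longleftrightarrow> equinum a c f"
proof
  assume "cardinal a c = cardinal a f"
  then show "equinum a c f" using cardinal(2) equinum_refl assms by metis
next
  assume e: "equinum a c f"
  show "cardinal a c = cardinal a f"
  proof (rule A_extensional[OF cardinal(1) cardinal(1)])
    show "E z (cardinal a c) \<longleftrightarrow> E z (cardinal a f)" for z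
      using cardinal(2) e equinum_trans equinum_sym assms by metis
  qed (use assms in auto)
qed

text \<open>Extending bijections by a point gives one inclusion, splitting them gives the other.\<close>
lemma succ_cardinal:
  assumes A: "c \<in> A r1" "c' \<in> A r1" and "add_one c c'"
  shows "succ a (cardinal a c) = cardinal a c'"
proof (rule A_extensional[OF succ(1)[OF cardinal(1)] cardinal(1)])
  fix g assume g: "g \<in> A r1"
  show "E g (succ a (cardinal a c)) \<longleftrightarrow> E g (cardinal a c')"
  proof
    assume "E g (succ a (cardinal a c))"
    then obtain f where f: "f \<in> A r1" "equinum a c f" "add_one f g"
      using succ(2)[OF cardinal(1)] cardinal(2) A by metis
    then have "equinum a c' g" using equinum_add_one[OF f(2) A(1) f(1) A(2) g assms(3) f(3)] by blast
    then show "E g (cardinal a c')" using g cardinal(2)[OF A(2)] by metis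
  next
    assume "E g (cardinal a c')"
    then have "equinum a c' g" using cardinal(2) A by metis
    then obtain f where "f \<in> A r1" "equinum a c f" "add_one f g"
      using equinum_split[OF _ A g assms(3)] by metis
    then show "E g (succ a (cardinal a c))"
      using succ(2)[OF cardinal(1)[OF A(1)]] cardinal(2)[OF A(1)] g by metis
  qed
qed (use A in auto)

lemma card_zero: "card_zero \<in> A r2" "E x card_zero \<longleftrightarrow> x = empty"
  unfolding card_zero_def using single empty_in_A by blast+

lemma card_zero_eq: "card_zero = cardinal a empty"
proof (rule A_extensional[OF card_zero(1) cardinal(1)[OF empty_in_A]])
  fix f assume f: "f \<in> A r1"
  have "equinum a empty f \<Longrightarrow> f = empty"
  proof -
    assume "equinum a empty f"
    then obtain g where "bij_rel empty f (pair_in g)" using empty_in_A f by (elim equinumE)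
    then have "\<not> E x f" for x using bij_relD(1,4) not_E_empty by metis
    then show ?thesis using A_extensional[OF f empty_in_A] not_E_empty by metis
  qed
  then show "E f card_zero \<longleftrightarrow> E f (cardinal a empty)"
    using card_zero(2) cardinal(2)[OF empty_in_A] f equinum_refl[OF empty_in_A] by metis
qed

lemma add_one_exists:
  assumes c: "c \<in> A r1" and z: "z \<in> A 0" "\<not> E z c"
  obtains c' where "c' \<in> A r1" "add_one c c'"
proof -
  have "definable ({c, z} \<union> range rank) [0] (\<lambda>xs. E (hd xs) c \<or> hd xs = z)"
    by (rule definable_disj definable_mem definable_eq ranked_term_tl ranked_term_hd ranked_term_const c z | simp)+
  from comprehension_A[OF params_finite this] obtain c' where
    "c' \<in> A r1" "\<And>x. E x c' \<longleftrightarrow> x \<in> A 0 \<and> (E x c \<or> x = z)"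
    using in_A_M c z by auto
  then show ?thesis using that z E_A0[OF c] unfolding add_one_def by metis
qed

lemma definable_cardinal:
  assumes "ranked_term K \<rho> r2 x" "ranked_term K \<rho> r1 c"
  shows "definable K \<rho> (\<lambda>xs. x xs = cardinal a (c xs))"
proof (rule definable_cong)
  show "definable K \<rho> (\<lambda>xs. \<forall>f\<in>A r1. E f (x xs) \<longleftrightarrow> equinum a (c xs) f)"
    by (rule definable_equinum definable_intros assms)+
  fix xs assume *: "params K" "typed \<rho> xs"
  note t = assms[THEN ranked_term_in[OF *(1)], OF *(2)]
  show "x xs = cardinal a (c xs) \<longleftrightarrow> (\<forall>f\<in>A r1. E f (x xs) \<longleftrightarrow> equinum a (c xs) f)"
    using A_extensional[OF t(1) cardinal(1)[OF t(2)]] cardinal(2)[OF t(2)] by metis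
qed

section \<open>The natural numbers of a discrete set\<close>

text \<open>The bound on the rank of an inductive set is kept apart, since it becomes the range of a quantifier
over rank 3.\<close>
definition closed_family :: "'a \<Rightarrow> bool" where
  "closed_family y \<longleftrightarrow> E card_zero y \<and> (\<forall>x. E x y \<longrightarrow> E (succ a x) y \<or> succ a x = empty)"

lemma inductive_in_iff: "y \<in> M \<and> inductive_in a y \<longleftrightarrow> y \<in> A r3 \<and> closed_family y"
proof -
  have "powerset (powerset a) = rank r2" by (simp add: rank_def)
  then have "y \<in> M \<and> sub y (powerset (powerset a)) \<longleftrightarrow> y \<in> A r3"
    unfolding sub_iff A_Suc[of r2] by simp
  then show ?thesis
    unfolding inductive_in_def closed_family_def using E_in_M by metis
qed

lemma definable_closed_family:
  assumes "card_zero \<in> K" "ranked_term K \<rho> r3 y"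
  shows "definable K \<rho> (\<lambda>xs. closed_family (y xs))"
proof (rule definable_cong)
  show "definable K \<rho> (\<lambda>xs. E card_zero (y xs) \<and> (\<forall>x\<in>A r2. E x (y xs) \<longrightarrow>
      (\<exists>s\<in>A r2. s = succ a x \<and> (E s (y xs) \<or> s = empty))))"
    by (rule definable_succ definable_empty definable_all definable_ex definable_conj definable_imp definable_disj definable_mem
        ranked_term_const[OF assms(1) card_zero(1)] ranked_term_hd ranked_term_tl assms(2))+
  fix xs assume *: "params K" "typed \<rho> xs"
  have "E x (y xs) \<Longrightarrow> x \<in> A r2" for x
    using ranked_term_in[OF *(1) assms(2) *(2)] in_A_SucD by blast
  then show "closed_family (y xs) \<longleftrightarrow> E card_zero (y xs) \<and> (\<forall>x\<in>A r2. E x (y xs) \<longrightarrow>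
      (\<exists>s\<in>A r2. s = succ a x \<and> (E s (y xs) \<or> s = empty)))"
    unfolding closed_family_def using succ(1) by metis
qed

abbreviation N :: 'a where
  "N \<equiv> naturals a"

lemma naturals:
  shows "N \<in> A r3" "E x N \<longleftrightarrow> x \<in> A r2 \<and> (\<forall>y\<in>A r3. closed_family y \<longrightarrow> E x y)"
proof -
  define P where "P x \<longleftrightarrow> (\<forall>y\<in>A r3. closed_family y \<longrightarrow> E x y)" for x
  have D: "definable ({card_zero} \<union> range rank) [r2] (\<lambda>xs. P (hd xs))"
    unfolding P_def by (rule definable_all definable_imp definable_mem definable_closed_family ranked_term_tl ranked_term_hd | simp)+
  have "powerset (powerset a) = rank r2" by (simp add: rank_def)
  then have *: "E x (powerset (powerset a)) \<and> (\<forall>y\<in>M. inductive_in a y \<longrightarrow> E x y) \<longleftrightarrow> x \<in> A r2 \<and> P x" for x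
    unfolding P_def using inductive_in_iff by (metis in_elts_iff)
  have fin: "finite {card_zero}" "{card_zero} \<subseteq> M" using card_zero(1) in_A_M by auto
  note the_set_A[where P = P, OF fin D *, folded naturals_def]
  then show "N \<in> A r3" "E x N \<longleftrightarrow> x \<in> A r2 \<and> (\<forall>y\<in>A r3. closed_family y \<longrightarrow> E x y)"
    unfolding P_def by blast+
qed

lemma natural_induct:
  assumes "y \<in> A r3" "closed_family y" "E x N" shows "E x y"
  using assms naturals(2) by metis

lemma natural_zero: "E card_zero N"
  unfolding naturals(2) closed_family_def using card_zero(1) by metis

text \<open>The cardinals form a definable closed family. For \<open>x = |c|\<close> either some \<open>f\<close> equinumerous with \<open>c\<close> misses
a point of \<open>a\<close>, and then \<open>succ x\<close> is the cardinal of \<open>f\<close> with this point added, or there is none and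
\<open>succ x\<close> is empty.\<close>
lemma natural_is_cardinal:
  assumes "E x N" obtains c where "c \<in> A r1" "x = cardinal a c"
proof -
  have "definable ({} \<union> range rank) [r2] (\<lambda>xs. \<exists>c\<in>A r1. hd xs = cardinal a c)"
    by (rule definable_ex definable_cardinal ranked_term_tl ranked_term_hd)+
  from comprehension_A[OF params_finite this] obtain Y where Y: "Y \<in> A r3"
    "\<And>x. E x Y \<longleftrightarrow> x \<in> A r2 \<and> (\<exists>c\<in>A r1. x = cardinal a c)" by auto
  have "closed_family Y"
    unfolding closed_family_def
  proof (intro conjI allI impI)
    show "E card_zero Y" unfolding Y(2) using card_zero(1) card_zero_eq empty_in_A by metis
    fix x assume "E x Y"
    then obtain c where c: "c \<in> A r1" "x = cardinal a c" unfolding Y(2) by blast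
    show "E (succ a x) Y \<or> succ a x = empty"
    proof (cases "\<exists>f z. E f x \<and> z \<in> A 0 \<and> \<not> E z f")
      case True
      then obtain f z where f: "E f x" "z \<in> A 0" "\<not> E z f" by blast
      have fA: "f \<in> A r1" "equinum a c f" using f(1) c cardinal(2) by metis+
      obtain f' where f': "f' \<in> A r1" "add_one f f'" using add_one_exists[OF fA(1) f(2,3)] by blast
      have "succ a x = cardinal a f'"
        using succ_cardinal[OF fA(1) f'] cardinal_eq_iff[OF c(1) fA(1)] fA(2) c(2) by metis
      then show ?thesis unfolding Y(2) using cardinal(1) f'(1) by metis
    next
      case False
      have xA: "x \<in> A r2" using c cardinal(1) by metis
      have "\<not> E c' (succ a x)" for c'
        using succ(2)[OF xA] False unfolding add_one_def by metis
      then have "succ a x = empty"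
        using A_extensional[OF succ(1)[OF xA] empty_in_A] not_E_empty by metis
      then show ?thesis by simp
    qed
  qed
  from natural_induct[OF Y(1) this assms] show ?thesis using that unfolding Y(2) by blast
qed

text \<open>If \<open>succ |c|\<close> is empty then no point of \<open>a\<close> lies outside \<open>c\<close>, so \<open>|a| = |c|\<close> is a natural number.\<close>
lemma succ_nonempty:
  assumes "Infinite a" "E x N" shows "succ a x \<noteq> empty"
proof
  assume e: "succ a x = empty"
  obtain c where c: "c \<in> A r1" "x = cardinal a c" using natural_is_cardinal[OF assms(2)] .
  have Ecx: "E c x" using c cardinal(2) equinum_refl by metis
  have xA: "x \<in> A r2" using c cardinal(1) by metis
  have all: "E z c" if z: "z \<in> A 0" for z
  proof (rule ccontr)
    assume "\<not> E z c"
    then obtain c' where "c' \<in> A r1" "add_one c c'" using add_one_exists[OF c(1) z] by blast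
    then have "E c' (succ a x)" unfolding succ(2)[OF xA] using Ecx by metis
    then show False using e not_E_empty by metis
  qed
  have aA: "a \<in> A r1" by (rule in_A_SucI[OF a_in_M]) (simp add: rank_0)
  have "c = a" by (rule A_extensional[OF c(1) aA]) (use all A0_iff in metis)
  then show False using assms c(2) unfolding Infinite_def by metis
qed

lemma natural_succ:
  assumes "Infinite a" "E x N" shows "E (succ a x) N"
proof -
  have "x \<in> A r2" using assms(2) naturals(2) by metis
  then show ?thesis
    using succ_nonempty[OF assms] assms(2) succ(1) unfolding naturals(2) closed_family_def by metis
qed

text \<open>A common element \<open>g\<close> of both successors arises by adding a point to a representative of each cardinal;
removing the two points from the identity on \<open>g\<close> makes the representatives equinumerous.\<close>
lemma succ_inj:
  assumes "Infinite a" "E x N" "E y N" "succ a x = succ a y" shows "x = y"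
proof -
  obtain c where c: "c \<in> A r1" "x = cardinal a c" using natural_is_cardinal[OF assms(2)] .
  obtain f where f: "f \<in> A r1" "y = cardinal a f" using natural_is_cardinal[OF assms(3)] .
  have A: "x \<in> A r2" "y \<in> A r2" using c f cardinal(1) by metis+
  have "\<exists>g. E g (succ a x)"
    using A_extensional[OF succ(1)[OF A(1)] empty_in_A] succ_nonempty[OF assms(1,2)] not_E_empty by metis
  then obtain g where g: "E g (succ a x)" "E g (succ a y)" using assms(4) by metis
  then have gA: "g \<in> A r1" using succ(2)[OF A(1)] by metis
  obtain c' where c': "E c' x" "add_one c' g" using g(1) succ(2)[OF A(1)] by metis
  obtain f' where f': "E f' y" "add_one f' g" using g(2) succ(2)[OF A(2)] by metis
  have cA: "c' \<in> A r1" "f' \<in> A r1" using c'(1) f'(1) in_A_SucD A by metis+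
  have "equinum a c' f'"
    using equinum_remove_one[OF equinum_refl[OF gA] cA gA gA c'(2) f'(2)] .
  then have "cardinal a c' = cardinal a f'" using cardinal_eq_iff[OF cA] by metis
  moreover have "x = cardinal a c'" "y = cardinal a f'"
    using c'(1) f'(1) c f cA cardinal(2) cardinal_eq_iff by metis+
  ultimately show ?thesis by simp
qed

lemma succ_neq_zero: "x \<in> A r2 \<Longrightarrow> succ a x \<noteq> card_zero"
proof
  assume x: "x \<in> A r2" and "succ a x = card_zero"
  then have "E empty (succ a x)" using card_zero(2) by metis
  then show False using succ(2)[OF x] not_E_empty unfolding add_one_def by metis
qed

section \<open>Full comprehension for the arithmetic structure\<close>

abbreviation nat_pow :: "nat \<Rightarrow> 'a" where
  "nat_pow n \<equiv> (powerset ^^ n) N"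

lemma N_separated: "N \<in> M" "separated \<epsilon> (elts N)"
proof -
  show "N \<in> M" using naturals(1) in_A_M by metis
  have "elts N \<subseteq> A r2" using naturals(2) by auto
  then show "separated \<epsilon> (elts N)" using rank_separated separated_subset by metis
qed

lemma elts_nat_pow_Suc: "elts (nat_pow (Suc n)) = {c \<in> M. elts c \<subseteq> elts (nat_pow n)}"
  using elts_iterated_powerset[OF N_separated] .

lemma elts_nat_pow_subset: "elts (nat_pow n) \<subseteq> A (Suc (Suc n))"
proof (induction n)
  case 0
  show ?case using naturals(2) by auto
next
  case (Suc n)
  then show ?case unfolding elts_nat_pow_Suc A_Suc[of "Suc (Suc n)"] by auto
qed

lemma nat_pow_in_A: "nat_pow n \<in> A (Suc (Suc (Suc n)))"
  unfolding A_Suc[of "Suc (Suc n)"] using elts_nat_pow_subset iterated_powerset(1)[OF N_separated] by blast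

lemma tval_in_A:
  assumes "has_sort s n" "\<And>m j. e m j \<in> A (Suc (Suc m))"
  shows "tval card_zero (succ a) e s \<in> A (Suc (Suc n))"
  using assms
proof (induction s arbitrary: n)
  case (Succ t)
  then show ?case using succ(1) by (metis has_sort.simps(3) tval.simps(3))
next
  case Zero
  then show ?case using card_zero(1) by (metis has_sort.simps(2) tval.simps(2))
qed simp

text \<open>The graph of a term is definable, not its value as a ranked term, since successors are not named by
variables: a nested successor is unfolded with an existential quantifier over rank 2.\<close>
lemma definable_tval:
  assumes "has_sort s n" "ranked_term K \<rho> (Suc (Suc n)) y" "\<And>m j. ranked_term K \<rho> (Suc (Suc m)) (\<sigma> m j)"
    and zK: "card_zero \<in> K"
  shows "definable K \<rho> (\<lambda>xs. y xs = tval card_zero (succ a) (\<lambda>m j. \<sigma> m j xs) s)"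
  using assms(1-3)
proof (induction s arbitrary: n \<rho> y \<sigma>)
  case (Var m j)
  then have m: "m = n" by simp
  show ?case unfolding tval.simps m by (rule definable_eq[OF Var(2) Var(3)])
next
  case Zero
  then have n: "n = 0" by simp
  show ?case unfolding tval.simps
    by (rule definable_eq[OF Zero(2)[unfolded n]] ranked_term_const zK card_zero(1))+
next
  case (Succ t)
  then have n: "n = 0" and t: "has_sort t 0" by auto
  show ?case
  proof (rule definable_cong)
    show "definable K \<rho> (\<lambda>xs. \<exists>x\<in>A r2. x = tval card_zero (succ a) (\<lambda>m j. \<sigma> m j xs) t \<and> y xs = succ a x)"
      by (rule definable_ex definable_conj definable_succ Succ.IH[OF t] ranked_term_hd ranked_term_tl Succ.prems(2)[unfolded n] Succ.prems(3))+
    fix xs assume *: "params K" "typed \<rho> xs"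
    have "tval card_zero (succ a) (\<lambda>m j. \<sigma> m j xs) t \<in> A r2"
      by (rule tval_in_A[OF t ranked_term_in[OF *(1) Succ.prems(3) *(2)]])
    then show "y xs = tval card_zero (succ a) (\<lambda>m j. \<sigma> m j xs) (Succ t) \<longleftrightarrow>
        (\<exists>x\<in>A r2. x = tval card_zero (succ a) (\<lambda>m j. \<sigma> m j xs) t \<and> y xs = succ a x)"
      by simp
  qed
qed

text \<open>Variables of sort \<open>n\<close> are interpreted by arbitrary terms of rank \<open>n + 2\<close>, not only by elements of the
sort. This lets the induction pass under a quantifier, where the new entry of the context is known
only by its rank; the restriction to the sort is a premise in the translated formula.\<close>
lemma definable_sat:
  assumes "well_sorted p" "\<And>m j. ranked_term K \<rho> (Suc (Suc m)) (\<sigma> m j)"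
    and K: "card_zero \<in> K" "range nat_pow \<subseteq> K"
  shows "definable K \<rho> (\<lambda>xs. sat (\<lambda>n. elts (nat_pow n)) (\<lambda>n. E) card_zero (succ a) p (\<lambda>m j. \<sigma> m j xs))"
  using assms(1,2)
proof (induction p arbitrary: \<rho> \<sigma>)
  case (Eq n s t)
  let ?v = "\<lambda>s xs. tval card_zero (succ a) (\<lambda>m j. \<sigma> m j xs) s"
  from Eq have st: "has_sort s n" "has_sort t n" by auto
  show ?case
  proof (rule definable_cong)
    show "definable K \<rho> (\<lambda>xs. \<exists>x\<in>A (Suc (Suc n)). x = ?v s xs \<and> x = ?v t xs)"
      by (rule definable_ex definable_conj definable_tval[OF st(1) _ _ K(1)] definable_tval[OF st(2) _ _ K(1)] ranked_term_hd ranked_term_tl Eq.prems(2))+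
    fix xs assume *: "params K" "typed \<rho> xs"
    have "?v s xs \<in> A (Suc (Suc n))"
      by (rule tval_in_A[OF st(1) ranked_term_in[OF *(1) Eq.prems(2) *(2)]])
    then show "sat (\<lambda>n. elts (nat_pow n)) (\<lambda>n. E) card_zero (succ a) (Eq n s t) (\<lambda>m j. \<sigma> m j xs) \<longleftrightarrow>
        (\<exists>x\<in>A (Suc (Suc n)). x = ?v s xs \<and> x = ?v t xs)" by auto
  qed
next
  case (Mem n s t)
  let ?v = "\<lambda>s xs. tval card_zero (succ a) (\<lambda>m j. \<sigma> m j xs) s"
  from Mem have st: "has_sort s n" "has_sort t (Suc n)" by auto
  show ?case
  proof (rule definable_cong)
    show "definable K \<rho> (\<lambda>xs. \<exists>x\<in>A (Suc (Suc n)). \<exists>y\<in>A (Suc (Suc (Suc n))). x = ?v s xs \<and> y = ?v t xs \<and> E x y)"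
      by (rule definable_ex definable_conj definable_mem definable_tval[OF st(1) _ _ K(1)] definable_tval[OF st(2) _ _ K(1)] ranked_term_hd ranked_term_tl Mem.prems(2))+
    fix xs assume *: "params K" "typed \<rho> xs"
    have "?v s xs \<in> A (Suc (Suc n))" "?v t xs \<in> A (Suc (Suc (Suc n)))"
      by (rule tval_in_A[OF st(1) ranked_term_in[OF *(1) Mem.prems(2) *(2)]]
          tval_in_A[OF st(2) ranked_term_in[OF *(1) Mem.prems(2) *(2)]])+
    then show "sat (\<lambda>n. elts (nat_pow n)) (\<lambda>n. E) card_zero (succ a) (Mem n s t) (\<lambda>m j. \<sigma> m j xs) \<longleftrightarrow>
        (\<exists>x\<in>A (Suc (Suc n)). \<exists>y\<in>A (Suc (Suc (Suc n))). x = ?v s xs \<and> y = ?v t xs \<and> E x y)" by auto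
  qed
next
  case (Neg p)
  then show ?case by (simp add: definable_not)
next
  case (Conj p q)
  then show ?case by (simp add: definable_conj)
next
  case (Forall n i p)
  let ?s = "sat (\<lambda>n. elts (nat_pow n)) (\<lambda>n. E) card_zero (succ a)"
  let ?\<sigma> = "\<lambda>m j. if m = n \<and> j = i then hd else (\<lambda>xs. \<sigma> m j (tl xs))"
  have "ranked_term K (Suc (Suc n) # \<rho>) (Suc (Suc m)) (?\<sigma> m j)" for m j
    using ranked_term_hd ranked_term_tl[OF Forall.prems(2)] by auto
  then have "definable K (Suc (Suc n) # \<rho>) (\<lambda>xs. ?s p (\<lambda>m j. ?\<sigma> m j xs))"
    using Forall.IH Forall.prems(1) by simp
  moreover have "(\<lambda>m j. ?\<sigma> m j xs) = upd (\<lambda>m j. \<sigma> m j (tl xs)) n i (hd xs)" for xs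
    unfolding upd_def by (intro ext) auto
  ultimately have IH: "definable K (Suc (Suc n) # \<rho>) (\<lambda>xs. ?s p (upd (\<lambda>m j. \<sigma> m j (tl xs)) n i (hd xs)))"
    by (simp only:)
  have pK: "nat_pow n \<in> K" using K(2) by blast
  show ?case
  proof (rule definable_cong)
    show "definable K \<rho> (\<lambda>xs. \<forall>x\<in>A (Suc (Suc n)). E x (nat_pow n) \<longrightarrow> ?s p (upd (\<lambda>m j. \<sigma> m j xs) n i x))"
      by (rule definable_all definable_imp definable_mem IH ranked_term_hd ranked_term_const[OF pK nat_pow_in_A])+
    fix xs
    show "?s (Forall n i p) (\<lambda>m j. \<sigma> m j xs) \<longleftrightarrow>
        (\<forall>x\<in>A (Suc (Suc n)). E x (nat_pow n) \<longrightarrow> ?s p (upd (\<lambda>m j. \<sigma> m j xs) n i x))"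
      unfolding sat.simps using elts_nat_pow_subset[of n] by (auto simp: subset_iff)
  qed
qed

lemma comprehension_nat_pow:
  assumes p: "well_sorted p" and e: "\<And>m j. e m j \<in> elts (nat_pow m)"
  shows "\<exists>X\<in>elts (nat_pow (Suc n)). \<forall>x\<in>elts (nat_pow n). E x X \<longleftrightarrow>
    sat (\<lambda>n. elts (nat_pow n)) (\<lambda>n. E) card_zero (succ a) p (upd e n i x)"
proof -
  let ?s = "sat (\<lambda>n. elts (nat_pow n)) (\<lambda>n. E) card_zero (succ a)"
  define K where "K = {card_zero} \<union> range rank \<union> range nat_pow \<union> (\<Union>m. range (e m))"
  have eA: "e m j \<in> A (Suc (Suc m))" for m j using e elts_nat_pow_subset by blast
  have "params K"
    unfolding params_def
  proof (intro conjI)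
    show "countable K" unfolding K_def by auto
    show "K \<subseteq> M" unfolding K_def
      using in_A_M[OF card_zero(1)] rank_in_M in_A_M[OF nat_pow_in_A] in_A_M[OF eA] by auto
  qed (auto simp: K_def)
  let ?\<sigma> = "\<lambda>m j. if m = n \<and> j = i then hd else (\<lambda>xs. e m j)"
  have "ranked_term K [Suc (Suc n)] (Suc (Suc m)) (?\<sigma> m j)" for m j
  proof -
    have "e m j \<in> K" unfolding K_def by blast
    then show ?thesis using ranked_term_hd[of K "Suc (Suc n)" "[]"] ranked_term_const[OF _ eA, of m j K] by simp
  qed
  then have "definable K [Suc (Suc n)] (\<lambda>xs. ?s p (\<lambda>m j. ?\<sigma> m j xs))"
    by (rule definable_sat[OF p]) (auto simp: K_def)
  moreover have "(\<lambda>m j. ?\<sigma> m j xs) = upd e n i (hd xs)" for xs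
    unfolding upd_def by (intro ext) auto
  ultimately have "definable K [Suc (Suc n)] (\<lambda>xs. ?s p (upd e n i (hd xs)))"
    by (simp only:)
  then have "definable K [Suc (Suc n)] (\<lambda>xs. E (hd xs) (nat_pow n) \<and> ?s p (upd e n i (hd xs)))"
    by (intro definable_conj definable_mem[OF ranked_term_hd ranked_term_const] nat_pow_in_A) (auto simp: K_def)
  from comprehension_A[OF \<open>params K\<close> this] obtain X where X: "X \<in> A (Suc (Suc (Suc n)))"
    "\<And>x. E x X \<longleftrightarrow> x \<in> A (Suc (Suc n)) \<and> E x (nat_pow n) \<and> ?s p (upd e n i x)" by metis
  have "X \<in> elts (nat_pow (Suc n))"
    unfolding elts_nat_pow_Suc using in_A_M[OF X(1)] X(2) by auto
  moreover have "\<forall>x\<in>elts (nat_pow n). E x X \<longleftrightarrow> ?s p (upd e n i x)"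
    using X(2) elts_nat_pow_subset[of n] by (auto simp: subset_iff)
  ultimately show ?thesis by blast
qed

theorem naturals_model:
  assumes inf: "Infinite a"
  shows "full_omega_arithmetic (\<lambda>n. elts (nat_pow n)) (\<lambda>n. E) card_zero (succ a)"
proof
  have T0: "elts (nat_pow 0) = elts N" by simp
  show "elts (nat_pow n) \<noteq> {}" for n
  proof (cases n)
    case 0
    then show ?thesis using natural_zero in_elts_iff by (metis T0 empty_iff)
  next
    case (Suc m)
    have "empty \<in> elts (nat_pow (Suc m))"
      unfolding elts_nat_pow_Suc using in_A_M[OF empty_in_A] not_E_empty by (auto simp: subset_iff)
    then show ?thesis using Suc by blast
  qed
  show "card_zero \<in> elts (nat_pow 0)" using natural_zero by simp
  show "succ a x \<in> elts (nat_pow 0)" if "x \<in> elts (nat_pow 0)" for x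
    using that natural_succ[OF inf] by simp
  show "inj_on (succ a) (elts (nat_pow 0))"
    by (rule inj_onI) (use succ_inj[OF inf] in simp)
  show "card_zero \<notin> succ a ` elts (nat_pow 0)"
    using succ_neq_zero naturals(2) by (metis T0 imageE in_elts_iff)
  show "\<forall>x\<in>elts (nat_pow 0). E x X"
    if X: "X \<in> elts (nat_pow 1)" "E card_zero X" "\<And>x. x \<in> elts (nat_pow 0) \<Longrightarrow> E x X \<Longrightarrow> E (succ a x) X" for X
  proof -
    have X': "X \<in> M" "elts X \<subseteq> elts N" using X(1) elts_nat_pow_Suc[of 0] by auto
    have "X \<in> A r3" using X(1) elts_nat_pow_subset[of 1] by (auto simp del: in_elts_iff)
    moreover have "closed_family X"
      unfolding closed_family_def using X(2,3) X'(2) T0 by (metis in_elts_iff subsetD)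
    ultimately show ?thesis using natural_induct by (metis T0 in_elts_iff)
  qed
  show "X = Y" if "X \<in> elts (nat_pow (Suc n))" "Y \<in> elts (nat_pow (Suc n))"
    "\<And>x. x \<in> elts (nat_pow n) \<Longrightarrow> E x X \<longleftrightarrow> E x Y" for n X Y
  proof (rule extensional)
    show "E z X \<longleftrightarrow> E z Y" for z
      using that unfolding elts_nat_pow_Suc by (metis (mono_tags, lifting) in_elts_iff mem_Collect_eq subsetD)
  qed (use that elts_subset in blast)+
  show "\<exists>X\<in>elts (nat_pow (Suc n)). \<forall>x\<in>elts (nat_pow n). E x X \<longleftrightarrow>
      sat (\<lambda>n. elts (nat_pow n)) (\<lambda>n. E) card_zero (succ a) p (upd e n i x)"
    if "well_sorted p" "\<And>m j. e m j \<in> elts (nat_pow m)" for n i p e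
    using comprehension_nat_pow[OF that] .
qed

end

theorem mainTheorem7:
  fixes M :: "'a set" and d :: "'a \<Rightarrow> 'a \<Rightarrow> real" and E :: "'a \<Rightarrow> 'a \<Rightarrow> bool" and a :: 'a
  assumes "MSE_model M d E"
    and "a \<in> M"
    and "set_operations.uniformly_discrete M E d a"
    and "set_operations.Infinite M E a"
  shows "full_omega_arithmetic
    (\<lambda>n. set_operations.elts M E
      ((set_operations.powerset M E ^^ n) (set_operations.naturals M E a)))
    (\<lambda>n. E)
    (set_operations.card_zero M E)
    (set_operations.succ M E a)"
proof -
  interpret mse M d E using assms(1) by (simp add: mse_def)
  obtain \<epsilon> where \<epsilon>: "\<epsilon> > 0" "\<And>x y. x \<in> elts a \<Longrightarrow> y \<in> elts a \<Longrightarrow> x \<noteq> y \<Longrightarrow> \<epsilon> \<le> d x y"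
    using assms(3) unfolding uniformly_discrete_def by blast
  interpret discrete_set M d E a "min \<epsilon> 1"
  proof
    show "separated (min \<epsilon> 1) (elts a)"
      unfolding separated_def using \<epsilon>(2) elts_subset by force
  qed (use assms(2) \<epsilon>(1) in auto)
  show ?thesis by (rule naturals_model[OF assms(4)])
qed

end
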